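(* Let $k$ and $m$ be non-negative integers with $m \le k+1$, and let $G$ be a connected $K_{1,4}$-free graph of order $n$. If $\sigma_{m+2}(G) \ge n-k$, then $G$ has a spanning tree $T$ with $|L(T)| + |B(T)| \le m+k+2$.
   Context: All graphs are finite, simple (no loops or multiple edges). For a tree $T$, a leaf is a vertex of degree one in $T$ and a branch vertex is a vertex of degree at least three in $T$; $L(T)$ and $B(T)$ denote the sets of leaves and of branch vertices of $T$. A graph is $K_{1,4}$-free if it contains no induced subgraph isomorphic to the star $K_{1,4}$. $\alpha(G)$ is the independence number of $G$. For a positive integer $p$, $\sigma_p(G)=+\infty$ if $\alpha(G)<p$, and otherwise $\sigma_p(G)=\min\{\sum_{i=1}^p d_G(v_i) : \{v_1,\dots,v_p\}$ is an independent set of $G\}$, where $d_G(v)$ is the degree of $v$ in $G$. *)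

theory Defs
  imports Main "HOL-Library.Extended_Nat"
begin

definition sgraph :: "'a set \<Rightarrow> ('a \<Rightarrow> 'a \<Rightarrow> bool) \<Rightarrow> bool" where
  "sgraph V adj \<longleftrightarrow> finite V \<and>
     (\<forall>u v. adj u v \<longrightarrow> u \<in> V \<and> v \<in> V \<and> u \<noteq> v \<and> adj v u)"

definition gconnected :: "'a set \<Rightarrow> ('a \<Rightarrow> 'a \<Rightarrow> bool) \<Rightarrow> bool" where
  "gconnected V adj \<longleftrightarrow> V \<noteq> {} \<and> (\<forall>u\<in>V. \<forall>v\<in>V. adj\<^sup>*\<^sup>* u v)"

definition deg :: "'a set \<Rightarrow> ('a \<Rightarrow> 'a \<Rightarrow> bool) \<Rightarrow> 'a \<Rightarrow> nat" where
  "deg V adj v = card {u \<in> V. adj v u}"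

definition indep :: "'a set \<Rightarrow> ('a \<Rightarrow> 'a \<Rightarrow> bool) \<Rightarrow> 'a set \<Rightarrow> bool" where
  "indep V adj S \<longleftrightarrow> S \<subseteq> V \<and> (\<forall>u\<in>S. \<forall>v\<in>S. \<not> adj u v)"

definition K14_free :: "'a set \<Rightarrow> ('a \<Rightarrow> 'a \<Rightarrow> bool) \<Rightarrow> bool" where
  "K14_free V adj \<longleftrightarrow>
     \<not> (\<exists>v\<in>V. \<exists>S. S \<subseteq> {u \<in> V. adj v u} \<and> card S = 4 \<and> indep V adj S)"

definition alpha :: "'a set \<Rightarrow> ('a \<Rightarrow> 'a \<Rightarrow> bool) \<Rightarrow> nat" where
  "alpha V adj = Max {card S | S. indep V adj S}"

definition sigma :: "'a set \<Rightarrow> ('a \<Rightarrow> 'a \<Rightarrow> bool) \<Rightarrow> nat \<Rightarrow> enat" where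
  "sigma V adj p = (if alpha V adj < p then \<infinity>
     else enat (Min {\<Sum>v\<in>S. deg V adj v | S. indep V adj S \<and> card S = p}))"

definition acyclic_graph :: "'a set \<Rightarrow> ('a \<Rightarrow> 'a \<Rightarrow> bool) \<Rightarrow> bool" where
  "acyclic_graph V T \<longleftrightarrow> \<not> (\<exists>cs. length cs \<ge> 3 \<and> distinct cs \<and> set cs \<subseteq> V \<and>
      (\<forall>i. i + 1 < length cs \<longrightarrow> T (cs ! i) (cs ! (i + 1))) \<and> T (last cs) (hd cs))"

definition is_tree :: "'a set \<Rightarrow> ('a \<Rightarrow> 'a \<Rightarrow> bool) \<Rightarrow> bool" where
  "is_tree V T \<longleftrightarrow> sgraph V T \<and> gconnected V T \<and> acyclic_graph V T"

definition spanning_tree :: "'a set \<Rightarrow> ('a \<Rightarrow> 'a \<Rightarrow> bool) \<Rightarrow> ('a \<Rightarrow> 'a \<Rightarrow> bool) \<Rightarrow> bool" where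
  "spanning_tree V adj T \<longleftrightarrow> is_tree V T \<and> (\<forall>u v. T u v \<longrightarrow> adj u v)"

definition leaves :: "'a set \<Rightarrow> ('a \<Rightarrow> 'a \<Rightarrow> bool) \<Rightarrow> 'a set" where
  "leaves V T = {v \<in> V. deg V T v = 1}"

definition branches :: "'a set \<Rightarrow> ('a \<Rightarrow> 'a \<Rightarrow> bool) \<Rightarrow> 'a set" where
  "branches V T = {v \<in> V. deg V T v \<ge> 3}"

end

(*
  Let T be a spanning tree with the fewest leaves, rooted at a leaf so that the sum of all depths is
  largest, and let S be a set of m+2 leaves containing the root. Charge the adjacency of x in S to a
  vertex v to the first edge of the T-path from v to x. Leaf-reducing exchanges and K_{1,4}-freeness
  show that no edge is charged twice, not even from its two sides. Pendant edges at leaves outside S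
  are not charged, and above every branch vertex, except the topmost one, the segment up to the next
  branch vertex has an uncharged end edge. Hence the degrees over S sum to at most n - |L - S| - |B|,
  which is less than n - k if |L| + |B| > m + k + 2. Since |B| <= |L| - 2, the assumption m <= k + 1
  guarantees that T has m + 2 leaves.
*)
theory Submission
  imports Defs
begin

section \<open>Degrees and distances\<close>

text \<open>The basic exchange: if a leaf \<open>x\<close> is adjacent to \<open>v\<close> and the
  tree path from \<open>v\<close> to \<open>x\<close> starts with \<open>u\<close> other than
  \<open>x\<close>, then trading \<open>vu\<close> for \<open>vx\<close> gives another tree with the
  fewest leaves, where \<open>u\<close> has replaced \<open>x\<close> as a leaf. What is known about
  leaves, above all that they are pairwise nonadjacent, then holds for \<open>u\<close> too. The
  obstacle is an edge charged twice from one side: two such leaves, \<open>u\<close> and a further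
  tree neighbour of \<open>v\<close> would form an induced star. Minimality alone cannot forbid an
  edge between two children of a branch vertex, since moving one child below the other need not
  lower the number of leaves; the total depth breaks this tie. A tree with two leaves would spoil
  the method, as the ends of a Hamiltonian path may be adjacent; the negated conclusion forces three
  leaves in every spanning tree. The bound has \<open>n\<close> in place of the number
  \<open>n - 1\<close> of edges because the topmost branch vertex may be paid for by the root
  itself.\<close>

lemma sgraphD:
  assumes "sgraph V T" "T u v"
  shows "u \<in> V" "v \<in> V" "u \<noteq> v" "T v u"
  using assms(1)[unfolded sgraph_def, THEN conjunct2, rule_format, OF assms(2)] by simp_all

lemma sgraph_finite: "sgraph V T \<Longrightarrow> finite V"
  unfolding sgraph_def by blast

lemma finite_nbrs: "sgraph V T \<Longrightarrow> finite {u \<in> V. T v u}"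
  by (drule sgraph_finite) simp

lemma deg_ge1:
  assumes "sgraph V T" "T v a"
  shows "deg V T v \<ge> 1"
proof -
  have "{a} \<subseteq> {u \<in> V. T v u}" using assms sgraphD by fastforce
  from card_mono[OF finite_nbrs[OF assms(1)] this] show ?thesis by (simp add: deg_def)
qed

lemma deg_ge2:
  assumes "sgraph V T" "T v a" "T v b" "a \<noteq> b"
  shows "deg V T v \<ge> 2"
proof -
  have "{a, b} \<subseteq> {u \<in> V. T v u}" using assms sgraphD by fastforce
  from card_mono[OF finite_nbrs[OF assms(1)] this] show ?thesis using assms(4) by (simp add: deg_def)
qed

lemma deg_ge3:
  assumes "sgraph V T" "T v a" "T v b" "T v c" "a \<noteq> b" "a \<noteq> c" "b \<noteq> c"
  shows "deg V T v \<ge> 3"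
proof -
  have "{a, b, c} \<subseteq> {u \<in> V. T v u}" using assms sgraphD by fastforce
  from card_mono[OF finite_nbrs[OF assms(1)] this] show ?thesis using assms(5-) by (simp add: deg_def)
qed

lemma deg_obtain_other:
  assumes "deg V T v \<ge> 2"
  obtains p where "T v p" "p \<noteq> u"
proof -
  have "\<not> {p \<in> V. T v p} \<subseteq> {u}"
  proof
    assume "{p \<in> V. T v p} \<subseteq> {u}"
    from card_mono[OF _ this] show False using assms by (simp add: deg_def)
  qed
  then show ?thesis using that by blast
qed

lemma deg_obtain_others:
  assumes "deg V T v \<ge> 3"
  obtains p q where "T v p" "T v q" "p \<noteq> u" "q \<noteq> u" "p \<noteq> q"
proof -
  have "deg V T v \<ge> 2" using assms by simp
  then obtain p where p: "T v p" "p \<noteq> u" by (rule deg_obtain_other)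
  have "card {u, p} \<le> 2" by (simp add: card_insert_le_m1)
  have "\<not> {q \<in> V. T v q} \<subseteq> {u, p}"
  proof
    assume "{q \<in> V. T v q} \<subseteq> {u, p}"
    from card_mono[OF _ this] show False using assms \<open>card {u, p} \<le> 2\<close> by (simp add: deg_def)
  qed
  then show ?thesis using that p by blast
qed

lemma rtranclp_symp:
  assumes "\<And>a b. R a b \<Longrightarrow> R b a" "R\<^sup>*\<^sup>* x y"
  shows "R\<^sup>*\<^sup>* y x"
  using assms(2) by induct (auto intro: assms(1) converse_rtranclp_into_rtranclp)

lemma rtranclp_transfer:
  assumes "R\<^sup>*\<^sup>* x y" "\<And>a b. R a b \<Longrightarrow> Q\<^sup>*\<^sup>* a b"
  shows "Q\<^sup>*\<^sup>* x y"
  using assms(1) by induct (auto intro: assms(2) rtranclp_trans)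

lemma gconnected_transfer:
  assumes "gconnected V T" "\<And>a b. T a b \<Longrightarrow> Q\<^sup>*\<^sup>* a b"
  shows "gconnected V Q"
  unfolding gconnected_def
proof (intro conjI ballI)
  fix u v assume "u \<in> V" "v \<in> V"
  then have "T\<^sup>*\<^sup>* u v" using assms(1) unfolding gconnected_def by blast
  then show "Q\<^sup>*\<^sup>* u v" by (rule rtranclp_transfer) (rule assms(2))
qed (use assms(1) in \<open>simp add: gconnected_def\<close>)

lemma gconnected_from:
  assumes "\<And>a b. T a b \<Longrightarrow> T b a" "r \<in> V" "\<And>v. v \<in> V \<Longrightarrow> T\<^sup>*\<^sup>* v r"
  shows "gconnected V T"
  unfolding gconnected_def
proof (intro conjI ballI)
  fix u v assume "u \<in> V" "v \<in> V"
  then show "T\<^sup>*\<^sup>* u v"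
    using rtranclp_trans[OF assms(3) rtranclp_symp[OF assms(1) assms(3)]] by blast
qed (use assms in auto)

section \<open>Distances from a root, parents, and the minimum number of edges of a connected
  graph\<close>

definition gdist :: "('a \<Rightarrow> 'a \<Rightarrow> bool) \<Rightarrow> 'a \<Rightarrow> 'a \<Rightarrow> nat" where
  "gdist T r v = (LEAST n. (T ^^ n) r v)"

text \<open>Unspecified at the root \<open>r\<close> itself.\<close>

definition parent :: "('a \<Rightarrow> 'a \<Rightarrow> bool) \<Rightarrow> 'a \<Rightarrow> 'a \<Rightarrow> 'a" where
  "parent T r v = (SOME u. T v u \<and> gdist T r v = Suc (gdist T r u))"

lemma gdist_self [simp]: "gdist T r r = 0"
  unfolding gdist_def by (rule Least_eq_0) simp

lemma gdist_path:
  assumes "gconnected V T" "r \<in> V" "v \<in> V"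
  shows "(T ^^ gdist T r v) r v"
proof -
  have "\<exists>n. (T ^^ n) r v" using assms unfolding gconnected_def by (meson rtranclp_imp_relpowp)
  then show ?thesis unfolding gdist_def by (rule LeastI_ex)
qed

lemma gdist_eq_0:
  assumes "gconnected V T" "r \<in> V" "v \<in> V" "gdist T r v = 0"
  shows "v = r"
  using gdist_path[OF assms(1-3)] assms(4) by simp

lemma gdist_edge:
  assumes "gconnected V T" "r \<in> V" "u \<in> V" "T u v"
  shows "gdist T r v \<le> Suc (gdist T r u)"
  unfolding gdist_def[of T r v]
  by (rule Least_le) (use gdist_path[OF assms(1-3)] assms(4) in auto)

text \<open>A walk of \<open>n\<close> edges raises the potential \<open>f\<close> by at most
  \<open>n\<close>. With the depth in an old tree as \<open>f\<close>, this shows that an exchange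
  lowers no depth.\<close>

lemma gdist_ge:
  assumes "gconnected V T" "r \<in> V" "v \<in> V"
    and f: "f r = 0" "\<And>a b. T a b \<Longrightarrow> f b \<le> Suc (f a)"
  shows "f v \<le> gdist T r v"
proof -
  have "(T ^^ n) r v \<Longrightarrow> f v \<le> n" for n
  proof (induct n arbitrary: v)
    case (Suc n)
    then obtain u where u: "(T ^^ n) r u" "T u v" by auto
    show ?case using Suc(1)[OF u(1)] f(2)[OF u(2)] by simp
  qed (use f(1) in simp)
  then show ?thesis using gdist_path[OF assms(1-3)] by blast
qed

lemma parent_step:
  assumes "gconnected V T" "sgraph V T" "r \<in> V" "v \<in> V" "v \<noteq> r"
  shows "T v (parent T r v)" "gdist T r v = Suc (gdist T r (parent T r v))" "parent T r v \<in> V"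
proof -
  have "gdist T r v \<noteq> 0" using gdist_eq_0 assms by metis
  then obtain n where n: "gdist T r v = Suc n" by (cases "gdist T r v") auto
  then have "(T ^^ Suc n) r v" using gdist_path assms by metis
  then obtain u where u: "(T ^^ n) r u" "T u v" by auto
  have uV: "u \<in> V" "T v u" using sgraphD assms u by metis+
  have "gdist T r u \<le> n" unfolding gdist_def using u(1) by (rule Least_le)
  moreover have "gdist T r v \<le> Suc (gdist T r u)" using gdist_edge assms uV u by metis
  ultimately have "T v u \<and> gdist T r v = Suc (gdist T r u)" using n uV by simp
  then have "T v (parent T r v) \<and> gdist T r v = Suc (gdist T r (parent T r v))"
    unfolding parent_def by (rule someI)
  then show "T v (parent T r v)" "gdist T r v = Suc (gdist T r (parent T r v))" "parent T r v \<in> V"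
    using assms sgraphD by metis+
qed

lemma sum_deg:
  assumes "finite V"
  shows "(\<Sum>v\<in>V. deg V T v) = card {(u, v). u \<in> V \<and> v \<in> V \<and> T u v}"
proof -
  have "{(u, v). u \<in> V \<and> v \<in> V \<and> T u v} = (SIGMA u:V. {v \<in> V. T u v})" by auto
  then show ?thesis using assms by (simp add: deg_def)
qed

text \<open>Each vertex except a root contributes the edge to its parent in both orientations, and
  depth keeps these ordered pairs apart. This is the minimum of \<open>n - 1\<close> edges,
  doubled.\<close>

lemma sum_deg_connected:
  assumes "gconnected V T" "sgraph V T"
  shows "2 * card V \<le> (\<Sum>v\<in>V. deg V T v) + 2"
proof -
  obtain r where r: "r \<in> V" using assms unfolding gconnected_def by auto
  note st = parent_step[OF assms r] and fin = sgraph_finite[OF assms(2)]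
  let ?A = "V - {r}" and ?p = "parent T r"
  let ?f = "\<lambda>v. (v, ?p v)" and ?g = "\<lambda>v. (?p v, v)"
  have inj: "inj_on ?f ?A" "inj_on ?g ?A" by (auto intro: inj_onI)
  have disj: "?f ` ?A \<inter> ?g ` ?A = {}"
  proof -
    have "?f v \<noteq> ?g w" if "v \<in> ?A" "w \<in> ?A" for v w
    proof
      assume "?f v = ?g w"
      then have e: "?p w = v" "?p v = w" by (metis Pair_inject)+
      have "gdist T r v = Suc (gdist T r w)" using st(2)[of v] that unfolding e by simp
      moreover have "gdist T r w = Suc (gdist T r v)" using st(2)[of w] that unfolding e by simp
      ultimately show False by simp
    qed
    then show ?thesis by blast
  qed
  have sub: "?f ` ?A \<union> ?g ` ?A \<subseteq> {(u, v). u \<in> V \<and> v \<in> V \<and> T u v}"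
    using st sgraphD[OF assms(2)] by auto
  have fin2: "finite {(u, v). u \<in> V \<and> v \<in> V \<and> T u v}"
    by (rule finite_subset[of _ "V \<times> V"]) (use fin in auto)
  have "card (?f ` ?A \<union> ?g ` ?A) = card ?A + card ?A"
    using disj inj fin by (simp add: card_Un_disjoint card_image)
  then have "2 * card ?A \<le> (\<Sum>v\<in>V. deg V T v)"
    using card_mono[OF fin2 sub] sum_deg[OF fin, of T] by simp
  then show ?thesis using r fin by simp
qed

section \<open>Trees\<close>

text \<open>Counting edges (through the degree sum) instead of forbidding cycles makes an edge exchange
  preserve trees by mere arithmetic once connectedness is known.\<close>

definition tree :: "'a set \<Rightarrow> ('a \<Rightarrow> 'a \<Rightarrow> bool) \<Rightarrow> bool" where
  "tree V T \<longleftrightarrow> sgraph V T \<and> gconnected V T \<and> (\<Sum>v\<in>V. deg V T v) + 2 \<le> 2 * card V"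

lemma treeD: "tree V T \<Longrightarrow> sgraph V T" "tree V T \<Longrightarrow> gconnected V T"
  unfolding tree_def by auto

text \<open>The breadth-first tree, which keeps only the edges from a vertex to its parent.\<close>

lemma tree_exists:
  assumes "sgraph V adj" "gconnected V adj"
  shows "\<exists>T. tree V T \<and> T \<le> adj"
proof -
  obtain r where r: "r \<in> V" using assms unfolding gconnected_def by auto
  note st = parent_step[OF assms(2,1) r] and fin = sgraph_finite[OF assms(1)]
  let ?A = "V - {r}" and ?p = "parent adj r"
  define T where "T = (\<lambda>u v. (u \<in> ?A \<and> v = ?p u) \<or> (v \<in> ?A \<and> u = ?p v))"
  have le: "T u v \<Longrightarrow> adj u v" for u v unfolding T_def using st sgraphD[OF assms(1)] by blast
  have sym: "T u v \<Longrightarrow> T v u" for u v unfolding T_def by blast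
  have sg: "sgraph V T" unfolding sgraph_def using fin le sym sgraphD[OF assms(1)] by blast
  have conn: "v \<in> V \<Longrightarrow> T\<^sup>*\<^sup>* v r" for v
  proof (induct "gdist adj r v" arbitrary: v rule: less_induct)
    case less
    show ?case
    proof (cases "v = r")
      case False
      then have "T v (?p v)" using less unfolding T_def by blast
      moreover have "T\<^sup>*\<^sup>* (?p v) r" using less st[of v] False by simp
      ultimately show ?thesis by (rule converse_rtranclp_into_rtranclp)
    qed simp
  qed
  have "gconnected V T" using gconnected_from sym r conn by metis
  moreover have "(\<Sum>v\<in>V. deg V T v) + 2 \<le> 2 * card V"
  proof -
    have "{(u, v). u \<in> V \<and> v \<in> V \<and> T u v} \<subseteq> (\<lambda>v. (v, ?p v)) ` ?A \<union> (\<lambda>v. (?p v, v)) ` ?A"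
      unfolding T_def by auto
    then have "card {(u, v). u \<in> V \<and> v \<in> V \<and> T u v} \<le> card ((\<lambda>v. (v, ?p v)) ` ?A \<union> (\<lambda>v. (?p v, v)) ` ?A)"
      using fin by (intro card_mono) auto
    also have "\<dots> \<le> card ?A + card ?A"
      by (rule order_trans[OF card_Un_le]) (use fin in \<open>auto intro!: add_mono card_image_le\<close>)
    finally have "(\<Sum>v\<in>V. deg V T v) \<le> 2 * card ?A" using sum_deg[OF fin, of T] by simp
    moreover have "card V \<ge> 1" using r fin by (metis One_nat_def Suc_leI card_gt_0_iff empty_iff)
    ultimately show ?thesis using r fin by simp
  qed
  ultimately show ?thesis using sg le unfolding tree_def le_fun_def le_bool_def by blast
qed

section \<open>Deleting and exchanging edges\<close>

definition del_edge :: "('a \<Rightarrow> 'a \<Rightarrow> bool) \<Rightarrow> 'a \<Rightarrow> 'a \<Rightarrow> 'a \<Rightarrow> 'a \<Rightarrow> bool" where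
  "del_edge T a b = (\<lambda>u v. T u v \<and> \<not> (u = a \<and> v = b) \<and> \<not> (u = b \<and> v = a))"

definition swap_edge :: "('a \<Rightarrow> 'a \<Rightarrow> bool) \<Rightarrow> 'a \<Rightarrow> 'a \<Rightarrow> 'a \<Rightarrow> 'a \<Rightarrow> 'a \<Rightarrow> 'a \<Rightarrow> bool" where
  "swap_edge T a b x y = (\<lambda>u v. del_edge T a b u v \<or> (u = x \<and> v = y) \<or> (u = y \<and> v = x))"

lemma deg_del_edge:
  assumes "sgraph V T" "T a b"
  shows "deg V (del_edge T a b) c + of_bool (c = a \<or> c = b) = deg V T c"
proof (cases "c = a \<or> c = b")
  case True
  define d where "d = (if c = a then b else a)"
  have "{u \<in> V. del_edge T a b c u} = {u \<in> V. T c u} - {d}"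
    using True sgraphD[OF assms(1,2)] unfolding del_edge_def d_def by auto
  moreover have "d \<in> {u \<in> V. T c u}"
    using True sgraphD[OF assms(1,2)] assms(2) unfolding d_def by auto
  ultimately have "Suc (deg V (del_edge T a b) c) = deg V T c"
    unfolding deg_def using card.remove[OF finite_nbrs[OF assms(1)], of d c] by simp
  then show ?thesis using True by simp
next
  case False
  then have "{u \<in> V. del_edge T a b c u} = {u \<in> V. T c u}" unfolding del_edge_def by auto
  then show ?thesis using False unfolding deg_def by simp
qed

lemma sgraph_del_edge: "sgraph V T \<Longrightarrow> sgraph V (del_edge T a b)"
  unfolding sgraph_def del_edge_def by blast

lemma sgraph_swap_edge: "\<lbrakk>sgraph V T; x \<in> V; y \<in> V; x \<noteq> y\<rbrakk> \<Longrightarrow> sgraph V (swap_edge T a b x y)"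
  unfolding sgraph_def swap_edge_def del_edge_def by blast

text \<open>Deleting \<open>xy\<close> from the exchanged graph leaves
  \<open>del_edge T a b\<close>, so the count for a deletion applies twice. Indicators on both sides
  cover all coincidences of ends: a shared end keeps its degree.\<close>

lemma deg_swap_edge:
  assumes "sgraph V T" "T a b" "x \<in> V" "y \<in> V" "x \<noteq> y" "\<not> T x y"
  shows "deg V (swap_edge T a b x y) c + of_bool (c = a \<or> c = b) = deg V T c + of_bool (c = x \<or> c = y)"
proof -
  note S = sgraph_swap_edge[OF assms(1,3,4,5), of a b]
  have "del_edge (swap_edge T a b x y) x y = del_edge T a b"
    using assms(6) sgraphD(4)[OF assms(1)] unfolding swap_edge_def del_edge_def by (intro ext) auto
  moreover have "swap_edge T a b x y x y" unfolding swap_edge_def by auto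
  ultimately show ?thesis
    using deg_del_edge[OF assms(1,2), of c] deg_del_edge[OF S, of x y c] by simp
qed

lemma sum_of_bool2:
  assumes "finite V" "a \<in> V" "b \<in> V" "a \<noteq> b"
  shows "(\<Sum>c\<in>V. of_bool (c = a \<or> c = b)) = (2::nat)"
proof -
  have "V \<inter> {c. c = a \<or> c = b} = {a, b}" using assms by auto
  then show ?thesis using assms by (simp add: sum.If_cases of_bool_def)
qed

lemma del_edge_sym: "sgraph V T \<Longrightarrow> del_edge T a b u v \<Longrightarrow> del_edge T a b v u"
  unfolding del_edge_def sgraph_def by blast

lemma del_edge_path_sym: "sgraph V T \<Longrightarrow> (del_edge T a b)\<^sup>*\<^sup>* u v \<Longrightarrow> (del_edge T a b)\<^sup>*\<^sup>* v u"
  using rtranclp_symp del_edge_sym by metis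

text \<open>If \<open>a\<close> and \<open>b\<close> stayed linked, the graph without
  \<open>ab\<close> would be connected with too few edges.\<close>

lemma bridge:
  assumes "tree V T" "T a b"
  shows "\<not> (del_edge T a b)\<^sup>*\<^sup>* a b"
proof
  assume ab: "(del_edge T a b)\<^sup>*\<^sup>* a b"
  have sg: "sgraph V T" and con: "gconnected V T" using assms(1) treeD by auto
  note ends = sgraphD[OF sg assms(2)]
  have "(del_edge T a b)\<^sup>*\<^sup>* u v" if "T u v" for u v
    using that ab del_edge_path_sym[OF sg ab] by (cases "del_edge T a b u v") (auto simp: del_edge_def)
  then have "gconnected V (del_edge T a b)" by (rule gconnected_transfer[OF con])
  from sum_deg_connected[OF this sgraph_del_edge[OF sg]]
  have "2 * card V \<le> (\<Sum>v\<in>V. deg V (del_edge T a b) v) + 2" .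
  moreover have "(\<Sum>v\<in>V. deg V (del_edge T a b) v) + 2 = (\<Sum>v\<in>V. deg V T v)"
    using sum_of_bool2[OF sgraph_finite[OF sg] ends(1-3)]
    by (subst deg_del_edge[OF sg assms(2), symmetric]) (simp add: sum.distrib)
  ultimately show False using assms(1) unfolding tree_def by simp
qed

text \<open>The new edge \<open>xy\<close> joins the two sides left by deleting \<open>ab\<close>,
  and the number of edges is unchanged. Cases such as \<open>x = a\<close> are included.\<close>

lemma exchange:
  assumes "tree V T" "T a b" "x \<in> V" "y \<in> V" "x \<noteq> y" "\<not> T x y"
    and "(del_edge T a b)\<^sup>*\<^sup>* x a" "(del_edge T a b)\<^sup>*\<^sup>* y b"
  shows "tree V (swap_edge T a b x y)"
proof -
  have sg: "sgraph V T" and con: "gconnected V T" using assms(1) treeD by auto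
  let ?S = "swap_edge T a b x y"
  have sgS: "sgraph V ?S" using sgraph_swap_edge[OF sg assms(3-5)] .
  have le: "del_edge T a b u v \<Longrightarrow> ?S\<^sup>*\<^sup>* u v" for u v unfolding swap_edge_def by auto
  have le2: "(del_edge T a b)\<^sup>*\<^sup>* u v \<Longrightarrow> ?S\<^sup>*\<^sup>* u v" for u v
    by (erule rtranclp_transfer) (erule le)
  have symS: "?S\<^sup>*\<^sup>* u v \<Longrightarrow> ?S\<^sup>*\<^sup>* v u" for u v
    by (rule rtranclp_symp[OF sgraphD(4)[OF sgS]])
  have "?S x y" unfolding swap_edge_def by simp
  then have "?S\<^sup>*\<^sup>* a y"
    by (rule rtranclp.rtrancl_into_rtrancl[OF symS[OF le2[OF assms(7)]]])
  then have ab: "?S\<^sup>*\<^sup>* a b"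
    by (rule rtranclp_trans) (rule le2[OF assms(8)])
  have "?S\<^sup>*\<^sup>* u v" if "T u v" for u v
    using that ab symS[OF ab] le[of u v] by (cases "del_edge T a b u v") (auto simp: del_edge_def)
  then have conS: "gconnected V ?S" by (rule gconnected_transfer[OF con])
  have "(\<Sum>c\<in>V. deg V ?S c + of_bool (c = a \<or> c = b)) = (\<Sum>c\<in>V. deg V T c + of_bool (c = x \<or> c = y))"
    using deg_swap_edge[OF sg assms(2-6)] by simp
  then have "(\<Sum>c\<in>V. deg V ?S c) = (\<Sum>c\<in>V. deg V T c)"
    using sum_of_bool2[OF sgraph_finite[OF sg] assms(3-5)]
      sum_of_bool2[OF sgraph_finite[OF sg] sgraphD(1-3)[OF sg assms(2)]] by (simp add: sum.distrib)
  then show ?thesis using assms(1) sgS conS unfolding tree_def by simp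
qed

text \<open>The rest of a cycle bypasses its closing edge, which then is no bridge.\<close>

lemma tree_acyclic:
  assumes "tree V T"
  shows "acyclic_graph V T"
  unfolding acyclic_graph_def
proof
  assume "\<exists>cs. length cs \<ge> 3 \<and> distinct cs \<and> set cs \<subseteq> V \<and>
      (\<forall>i. i + 1 < length cs \<longrightarrow> T (cs ! i) (cs ! (i + 1))) \<and> T (last cs) (hd cs)"
  then obtain cs where cs: "length cs \<ge> 3" "distinct cs"
    "\<And>i. i + 1 < length cs \<Longrightarrow> T (cs ! i) (cs ! (i + 1))" "T (last cs) (hd cs)" by blast
  let ?n = "length cs - 1"
  have "cs \<noteq> []" using cs(1) by auto
  have hl: "hd cs = cs ! 0" "last cs = cs ! ?n" 
    using hd_conv_nth[of cs] last_conv_nth[of cs] cs(1) by (cases "cs = []"; simp)+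
  have "i \<le> ?n \<Longrightarrow> (del_edge T (last cs) (hd cs))\<^sup>*\<^sup>* (cs ! 0) (cs ! i)" for i
  proof (induct i)
    case (Suc i)
    have "del_edge T (last cs) (hd cs) (cs ! i) (cs ! Suc i)"
      unfolding del_edge_def hl
      using Suc(2) cs(1) cs(3)[of i] \<open>cs \<noteq> []\<close> nth_eq_iff_index_eq[OF cs(2), of i 0]
        nth_eq_iff_index_eq[OF cs(2), of "Suc i" 0] nth_eq_iff_index_eq[OF cs(2), of "i" ?n]
        nth_eq_iff_index_eq[OF cs(2), of "Suc i" ?n] by auto
    then show ?case using Suc by simp
  qed simp
  from this[of ?n] have "(del_edge T (last cs) (hd cs))\<^sup>*\<^sup>* (hd cs) (last cs)" using hl by simp
  from del_edge_path_sym[OF treeD(1)[OF assms] this] show False using bridge[OF assms cs(4)] by blast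
qed

lemma tree_spanning: "tree V T \<Longrightarrow> T \<le> adj \<Longrightarrow> spanning_tree V adj T"
  unfolding spanning_tree_def is_tree_def using tree_acyclic treeD by blast

lemma tree_deg_pos:
  assumes "tree V T" "card V \<ge> 2" "v \<in> V"
  shows "deg V T v \<ge> 1"
proof -
  have "\<not> V \<subseteq> {v}" using assms(2) card_mono[of "{v}" V] by auto
  then obtain w where "w \<in> V" "w \<noteq> v" by blast
  then have "T\<^sup>*\<^sup>* v w" using assms treeD(2) unfolding gconnected_def by blast
  then obtain u where "T v u" using \<open>w \<noteq> v\<close> by (cases rule: converse_rtranclpE) auto
  then show ?thesis using deg_ge1 treeD(1)[OF assms(1)] by metis
qed

text \<open>At each vertex, 2 plus the branch indicator is at most the degree plus the leaf
  indicator; the degrees sum to at most \<open>2n - 2\<close>.\<close>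

lemma card_branches:
  assumes "tree V T" "card V \<ge> 2"
  shows "card (branches V T) + 2 \<le> card (leaves V T)"
proof -
  have fin: "finite V" using assms treeD sgraph_finite by blast
  have "(\<Sum>v\<in>V. 2) + (\<Sum>v\<in>V. of_bool (v \<in> branches V T))
      \<le> (\<Sum>v\<in>V. deg V T v) + (\<Sum>v\<in>V. of_bool (v \<in> leaves V T))"
    unfolding sum.distrib[symmetric]
    by (rule sum_mono) (use tree_deg_pos[OF assms] in \<open>force simp: branches_def leaves_def\<close>)
  moreover have "(\<Sum>v\<in>V. of_bool (v \<in> branches V T)) = card (branches V T)"
    using fin by (simp add: branches_def of_bool_def sum.If_cases Int_def)
  moreover have "(\<Sum>v\<in>V. of_bool (v \<in> leaves V T)) = card (leaves V T)"
    using fin by (simp add: leaves_def of_bool_def sum.If_cases Int_def)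
  ultimately show ?thesis using assms(1) fin unfolding tree_def by simp
qed

section \<open>Directions\<close>

definition avoiding :: "('a \<Rightarrow> 'a \<Rightarrow> bool) \<Rightarrow> 'a \<Rightarrow> 'a \<Rightarrow> 'a \<Rightarrow> bool" where
  "avoiding T v = (\<lambda>a b. T a b \<and> a \<noteq> v \<and> b \<noteq> v)"

text \<open>\<open>toward T v u x\<close>: in the tree \<open>T\<close>, \<open>u\<close> is the neighbour of \<open>v\<close> on the path to \<open>x\<close>.\<close>

definition toward :: "('a \<Rightarrow> 'a \<Rightarrow> bool) \<Rightarrow> 'a \<Rightarrow> 'a \<Rightarrow> 'a \<Rightarrow> bool" where
  "toward T v u x \<longleftrightarrow> T v u \<and> (avoiding T v)\<^sup>*\<^sup>* u x"

lemma avoiding_sym: "sgraph V T \<Longrightarrow> (avoiding T v)\<^sup>*\<^sup>* a b \<Longrightarrow> (avoiding T v)\<^sup>*\<^sup>* b a"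
  by (rule rtranclp_symp[rotated]) (auto simp: avoiding_def dest: sgraphD(4))

lemma avoiding_del_edge: "(avoiding T v)\<^sup>*\<^sup>* a b \<Longrightarrow> (del_edge T v w)\<^sup>*\<^sup>* a b"
  by (erule rtranclp_mono[THEN predicate2D, rotated]) (auto simp: avoiding_def del_edge_def)

lemma del_edge_commute: "del_edge T a b = del_edge T b a"
  unfolding del_edge_def by auto

lemma towardI_self: "T v u \<Longrightarrow> toward T v u u"
  unfolding toward_def by simp

lemma towardD: "toward T v u x \<Longrightarrow> T v u" "toward T v u x \<Longrightarrow> (avoiding T v)\<^sup>*\<^sup>* u x"
  unfolding toward_def by simp_all

lemma towardI: "T v u \<Longrightarrow> (avoiding T v)\<^sup>*\<^sup>* u x \<Longrightarrow> toward T v u x"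
  unfolding toward_def by simp

text \<open>Along a walk from \<open>v\<close> to \<open>x\<close>, the last departure from
  \<open>v\<close> determines \<open>u\<close>.\<close>

lemma toward_exists:
  assumes "gconnected V T" "x \<in> V" "v \<in> V" "x \<noteq> v"
  shows "\<exists>u. toward T v u x"
proof -
  have "T\<^sup>*\<^sup>* v x" using assms unfolding gconnected_def by blast
  then have "x = v \<or> (\<exists>u. toward T v u x)"
  proof induct
    case (step z z')
    show ?case
    proof (cases "z' = v \<or> z = v")
      case True
      then show ?thesis using step(2) towardI_self by metis
    next
      case False
      then obtain u where u: "toward T v u z" using step(3) by auto
      have "avoiding T v z z'" using False step(2) unfolding avoiding_def by auto
      then have "toward T v u z'"
        by (intro towardI towardD(1)[OF u] rtranclp.rtrancl_into_rtrancl[OF towardD(2)[OF u]])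
      then show ?thesis by blast
    qed
  qed simp
  then show ?thesis using assms(4) by blast
qed

text \<open>Two different first steps would close a cycle through \<open>v\<close>, so the edge
  \<open>vu\<close> would be no bridge.\<close>

lemma toward_unique:
  assumes "tree V T" "toward T v u x" "toward T v u' x"
  shows "u = u'"
proof (rule ccontr)
  assume ne: "u \<noteq> u'"
  note sg = treeD(1)[OF assms(1)]
  note e = towardD(1)[OF assms(2)] towardD(1)[OF assms(3)]
  have "(avoiding T v)\<^sup>*\<^sup>* u' u"
    by (rule rtranclp_trans[OF towardD(2)[OF assms(3)] avoiding_sym[OF sg towardD(2)[OF assms(2)]]])
  then have "(del_edge T v u)\<^sup>*\<^sup>* u' u" by (rule avoiding_del_edge)
  moreover have "del_edge T v u v u'" using e ne sgraphD(3)[OF sg] unfolding del_edge_def by auto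
  ultimately have "(del_edge T v u)\<^sup>*\<^sup>* v u" by (rule converse_rtranclp_into_rtranclp[rotated])
  then show False using bridge[OF assms(1) e(1)] by blast
qed

text \<open>The path from \<open>u\<close> to \<open>x\<close> misses \<open>p\<close>, which would
  otherwise lie in two directions from \<open>v\<close>. Prefixed with \<open>v\<close> it is
  therefore a valid path as seen from \<open>p\<close>.\<close>

lemma toward_flip:
  assumes "tree V T" "toward T v u x" "T v p" "p \<noteq> u"
  shows "toward T p v x"
proof -
  note sg = treeD(1)[OF assms(1)]
  note vu = towardD[OF assms(2)]
  have ne: "z \<noteq> p" if "(avoiding T v)\<^sup>*\<^sup>* u z" for z
    using toward_unique[OF assms(1), of v u z p] towardI[of T v u z] vu(1) that
      towardI_self[of T v p] assms(3,4) by auto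
  from vu(2) have "(avoiding T p)\<^sup>*\<^sup>* u x"
  proof induct
    case (step z z')
    have "(avoiding T v)\<^sup>*\<^sup>* u z'" using step(1,2) by (rule rtranclp.rtrancl_into_rtrancl)
    then have "avoiding T p z z'" using ne[OF step(1)] ne step(2) unfolding avoiding_def by auto
    with step(3) show ?case by (rule rtranclp.rtrancl_into_rtrancl)
  qed simp
  moreover have "avoiding T p v u"
    using vu(1) ne[OF rtranclp.rtrancl_refl] sgraphD(3)[OF sg assms(3)] unfolding avoiding_def by auto
  ultimately have "(avoiding T p)\<^sup>*\<^sup>* v x" by (rule converse_rtranclp_into_rtranclp[rotated])
  then show ?thesis using towardI[of T p v x] sgraphD(4)[OF sg assms(3)] by simp
qed

text \<open>Deleting the edge \<open>vu\<close> separates its ends, and \<open>x\<close> is on only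
  one side.\<close>

lemma toward_antisym:
  assumes "tree V T" "toward T v u x"
  shows "\<not> toward T u v x"
proof
  assume uv: "toward T u v x"
  note sg = treeD(1)[OF assms(1)]
  note ux = avoiding_del_edge[OF towardD(2)[OF assms(2)], of u]
  have vx: "(del_edge T v u)\<^sup>*\<^sup>* v x"
    using avoiding_del_edge[OF towardD(2)[OF uv], of v] unfolding del_edge_commute[of T u v] .
  have "(del_edge T v u)\<^sup>*\<^sup>* v u" by (rule rtranclp_trans[OF vx del_edge_path_sym[OF sg ux]])
  then show False using bridge[OF assms(1) towardD(1)[OF assms(2)]] by blast
qed

lemma toward_next:
  assumes "tree V T" "toward T v u x" "x \<in> V" "u \<noteq> x"
  obtains u' where "toward T u u' x" "u' \<noteq> v"
proof -
  have "u \<in> V" by (rule sgraphD(2)[OF treeD(1)[OF assms(1)] towardD(1)[OF assms(2)]])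
  then obtain u' where "toward T u u' x"
    using toward_exists[OF treeD(2)[OF assms(1)] assms(3)] assms(4) by auto
  then show ?thesis using that toward_antisym[OF assms(1,2)] by blast
qed

lemma toward_deg_ge2:
  assumes "tree V T" "toward T v u x" "x \<in> V" "u \<noteq> x"
  shows "deg V T u \<ge> 2"
proof -
  note sg = treeD(1)[OF assms(1)]
  obtain u' where "toward T u u' x" "u' \<noteq> v" using toward_next[OF assms] .
  then show ?thesis
    using deg_ge2[OF sg, of u u' v] towardD(1)[of T u u' x] sgraphD(4)[OF sg towardD(1)[OF assms(2)]] by simp
qed

text \<open>Climbing from \<open>b\<close> through parents reaches only depths below that of
  \<open>b\<close>, hence below that of \<open>a\<close>, and so never meets
  \<open>a\<close>.\<close>

lemma toward_root:
  assumes "gconnected V T" "sgraph V T" "r \<in> V" "T a b" "gdist T r b \<le> gdist T r a"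
  shows "toward T a b r"
proof -
  note st = parent_step[OF assms(1-3)] and ab = sgraphD[OF assms(2,4)]
  have "b \<in> V \<Longrightarrow> a \<noteq> b \<Longrightarrow> gdist T r b \<le> gdist T r a \<Longrightarrow> (avoiding T a)\<^sup>*\<^sup>* b r" for b
  proof (induct "gdist T r b" arbitrary: b rule: less_induct)
    case less
    show ?case
    proof (cases "b = r")
      case False
      let ?c = "parent T r b"
      have c: "T b ?c" "gdist T r b = Suc (gdist T r ?c)" "?c \<in> V" using st less False by auto
      then have "a \<noteq> ?c" using less(4) by auto
      then have "avoiding T a b ?c" using c less(3) unfolding avoiding_def by auto
      moreover have "(avoiding T a)\<^sup>*\<^sup>* ?c r" using less(1)[of ?c] c \<open>a \<noteq> ?c\<close> less(4) by simp
      ultimately show ?thesis by (rule converse_rtranclp_into_rtranclp)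
    qed simp
  qed
  from this[OF ab(2,3) assms(5)] show ?thesis using towardI[of T a b r] assms(4) by simp
qed

lemma parent_toward:
  assumes "gconnected V T" "sgraph V T" "r \<in> V" "v \<in> V" "v \<noteq> r"
  shows "toward T v (parent T r v) r"
  by (rule toward_root[OF assms(1-3)]) (use parent_step[OF assms] in auto)

text \<open>The choice in \<open>parent\<close> is forced in a tree, because the direction towards
  the root is unique.\<close>

lemma edge_parent:
  assumes "tree V T" "r \<in> V" "T a b"
  shows "(a \<noteq> r \<and> b = parent T r a) \<or> (b \<noteq> r \<and> a = parent T r b)"
proof -
  note sg = treeD(1)[OF assms(1)] and con = treeD(2)[OF assms(1)]
  have *: "a \<noteq> r \<and> b = parent T r a" if ab: "T a b" "gdist T r b \<le> gdist T r a" for a b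
  proof -
    have "a \<noteq> r" using ab gdist_eq_0[OF con assms(2), of b] sgraphD[OF sg ab(1)] by auto
    then show ?thesis
      using toward_unique[OF assms(1) toward_root[OF con sg assms(2) ab] parent_toward[OF con sg assms(2)]]
        sgraphD[OF sg ab(1)] by auto
  qed
  show ?thesis using *[OF assms(3)] *[OF sgraphD(4)[OF sg assms(3)]] by (cases "gdist T r b \<le> gdist T r a") auto
qed

lemma child:
  assumes "tree V T" "r \<in> V" "T a b" "a = r \<or> b \<noteq> parent T r a"
  shows "b \<noteq> r" "parent T r b = a" "gdist T r b = Suc (gdist T r a)"
  using edge_parent[OF assms(1-3)] assms(4) parent_step(2)[OF treeD(2)[OF assms(1)] treeD(1)[OF assms(1)] assms(2), of b]
    sgraphD[OF treeD(1)[OF assms(1)] assms(3)] by auto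

section \<open>Trees with the minimum number of leaves\<close>

definition leaf_minimal :: "'a set \<Rightarrow> ('a \<Rightarrow> 'a \<Rightarrow> bool) \<Rightarrow> ('a \<Rightarrow> 'a \<Rightarrow> bool) \<Rightarrow> bool" where
  "leaf_minimal V adj T \<longleftrightarrow> tree V T \<and> T \<le> adj \<and>
     (\<forall>T'. tree V T' \<longrightarrow> T' \<le> adj \<longrightarrow> card (leaves V T) \<le> card (leaves V T'))"

lemma leaf_minimalD:
  assumes "leaf_minimal V adj T"
  shows "tree V T" "sgraph V T" "gconnected V T" "T u v \<Longrightarrow> adj u v"
  using assms treeD unfolding leaf_minimal_def by auto

lemma leaf_minimal_le:
  assumes "leaf_minimal V adj T" "tree V T'" "T' \<le> adj"
  shows "card (leaves V T) \<le> card (leaves V T')"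
  using assms unfolding leaf_minimal_def by blast

lemma leaf_minimalI:
  assumes "leaf_minimal V adj T" "tree V T'" "T' \<le> adj" "card (leaves V T') \<le> card (leaves V T)"
  shows "leaf_minimal V adj T'"
  using assms unfolding leaf_minimal_def by (meson order_trans)

lemma finite_leaves: "sgraph V T \<Longrightarrow> finite (leaves V T)"
  unfolding leaves_def by (drule sgraph_finite) simp

lemma leafD: "x \<in> leaves V T \<Longrightarrow> x \<in> V" "x \<in> leaves V T \<Longrightarrow> deg V T x = 1"
  unfolding leaves_def by auto

lemma swap_edge_le: "sgraph V adj \<Longrightarrow> T \<le> adj \<Longrightarrow> adj x y \<Longrightarrow> swap_edge T a b x y \<le> adj"
  unfolding swap_edge_def del_edge_def le_fun_def le_bool_def by (auto dest: sgraphD(4))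

lemma leaves_subset_card:
  assumes "finite (leaves V T)" "L \<subseteq> insert q (leaves V T - {y})" "y \<in> leaves V T"
  shows "card L \<le> card (leaves V T)"
proof -
  have "card L \<le> card (insert q (leaves V T - {y}))" using assms by (intro card_mono) auto
  also have "\<dots> \<le> Suc (card (leaves V T - {y}))" using assms(1) by (simp add: card_insert_if)
  also have "\<dots> = card (leaves V T)" using card.remove[OF assms(1,3)] by simp
  finally show ?thesis .
qed

lemma toward_neq: "sgraph V T \<Longrightarrow> toward T v u x \<Longrightarrow> x \<noteq> v"
proof -
  assume "sgraph V T" "toward T v u x"
  then have "u \<noteq> v" using towardD(1) sgraphD(3) by metis
  from towardD(2)[OF \<open>toward T v u x\<close>] show ?thesis by (cases rule: rtranclp.cases) (use \<open>u \<noteq> v\<close> in \<open>auto simp: avoiding_def\<close>)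
qed

lemma leaf_nbr_unique:
  assumes "sgraph V T" "x \<in> leaves V T" "T x a" "T x b"
  shows "a = b"
  using deg_ge2[OF assms(1,3,4)] leafD(2)[OF assms(2)] by fastforce

lemma leaf_toward:
  assumes "tree V T" "toward T v u x" "x \<in> V" "u \<in> leaves V T"
  shows "u = x"
  using toward_deg_ge2[OF assms(1-3)] leafD(2)[OF assms(4)] by fastforce

lemma toward_to_nbr:
  assumes "tree V T" "toward T v u x" "T v x"
  shows "u = x"
  by (rule toward_unique[OF assms(1,2)]) (rule towardI_self[of T v x], fact)

text \<open>The vertex \<open>p\<close> is the median of the three leaves: move along the path
  between \<open>x\<close> and \<open>y\<close> towards \<open>z\<close> until the direction to
  \<open>z\<close> differs from both directions along the path.\<close>

lemma branch_between:
  assumes T: "tree V T" and lv: "x \<in> leaves V T" "y \<in> leaves V T" "z \<in> leaves V T"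
    and ne: "x \<noteq> y" "x \<noteq> z" "y \<noteq> z"
  shows "\<exists>p a b. toward T p a x \<and> toward T p b y \<and> a \<noteq> b \<and> deg V T p \<ge> 3"
proof -
  note sg = treeD(1)[OF T] and con = treeD(2)[OF T]
  note xyz = lv[THEN leafD(1)]
  note st = parent_step[OF con sg xyz(3)]
  have ind: "toward T p a x \<Longrightarrow> toward T p b y \<Longrightarrow> a \<noteq> b \<Longrightarrow> ?thesis" for p a b
  proof (induct "gdist T z p" arbitrary: p a b rule: less_induct)
    case less
    note e = towardD(1)[OF less(2)] towardD(1)[OF less(3)]
    have pV: "p \<in> V" using sgraphD(1)[OF sg e(1)] .
    have pz: "p \<noteq> z" using leaf_nbr_unique[OF sg lv(3), of a b] e less(4) by blast
    let ?c = "parent T z p"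
    have c: "toward T p ?c z" using parent_toward[OF con sg xyz(3) pV pz] .
    have cd: "gdist T z ?c < gdist T z p" using st(2)[OF pV pz] by simp
    consider "?c = a" | "?c = b" | "?c \<noteq> a" "?c \<noteq> b" by blast
    then show ?case
    proof cases
      case 1
      have "a \<noteq> x" using leaf_toward[OF T c xyz(3)] 1 lv(1) ne(2) by auto
      then obtain a' where "toward T a a' x" "a' \<noteq> p" using toward_next[OF T less(2) xyz(1)] by blast
      moreover have "toward T a p y" using toward_flip[OF T less(3) e(1) less(4)] .
      ultimately show ?thesis using less(1)[of a a' p] cd 1 by blast
    next
      case 2
      have "b \<noteq> y" using leaf_toward[OF T c xyz(3)] 2 lv(2) ne(3) by auto
      then obtain b' where "toward T b b' y" "b' \<noteq> p" using toward_next[OF T less(3) xyz(2)] by blast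
      moreover have "toward T b p x" using toward_flip[OF T less(2) e(2)] less(4) by blast
      ultimately show ?thesis using less(1)[of b p b'] cd 2 by blast
    next
      case 3
      then have "deg V T p \<ge> 3" using deg_ge3[OF sg e towardD(1)[OF c] less(4)] by blast
      then show ?thesis using less(2-4) by blast
    qed
  qed
  obtain x1 where x1: "toward T x x1 y" using toward_exists[OF con xyz(2,1)] ne(1) by blast
  note sx = sgraphD[OF sg towardD(1)[OF x1]]
  have "x1 \<noteq> y"
  proof
    assume "x1 = y"
    obtain u where "toward T x u z" using toward_exists[OF con xyz(3,1)] ne(2) by blast
    moreover from this have "u = y"
      using leaf_nbr_unique[OF sg lv(1), of u x1] towardD(1)[of T x u z] towardD(1)[OF x1] \<open>x1 = y\<close> by simp
    ultimately show False using leaf_toward[OF T _ xyz(3) lv(2)] ne(3) by blast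
  qed
  then obtain b where b: "toward T x1 b y" using toward_next[OF T x1 xyz(2)] by blast
  have "b \<noteq> x" using toward_antisym[OF T x1] b by blast
  then show ?thesis using ind[OF _ b] towardI_self[of T x1 x] sx(4) by simp
qed

section \<open>Nonadjacencies forced by leaf minimality and by the absence of induced stars\<close>

locale three_leaf_host =
  fixes V :: "'a set" and adj :: "'a \<Rightarrow> 'a \<Rightarrow> bool"
  assumes graph: "sgraph V adj" and K14: "K14_free V adj"
    and three_leaves: "\<And>T. tree V T \<Longrightarrow> T \<le> adj \<Longrightarrow> 3 \<le> card (leaves V T)"
begin

lemma adj_sym: "adj u v \<Longrightarrow> adj v u"
  using sgraphD(4)[OF graph] .

lemma no_K14:
  assumes "adj v a" "adj v b" "adj v c" "adj v d"
    "a \<noteq> b" "a \<noteq> c" "a \<noteq> d" "b \<noteq> c" "b \<noteq> d" "c \<noteq> d"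
    "\<not> adj a b" "\<not> adj a c" "\<not> adj a d" "\<not> adj b c" "\<not> adj b d" "\<not> adj c d"
  shows False
proof -
  have "card {a, b, c, d} = 4" using assms by simp
  moreover have "indep V adj {a, b, c, d}"
  proof -
    have "\<not> adj u u" for u using sgraphD(3)[OF graph] by blast
    moreover have "\<not> adj b a" "\<not> adj c a" "\<not> adj d a" "\<not> adj c b" "\<not> adj d b" "\<not> adj d c"
      using assms(11-) adj_sym by blast+
    moreover have "a \<in> V" "b \<in> V" "c \<in> V" "d \<in> V"
      using assms(1-4) sgraphD(2)[OF graph] by blast+
    ultimately show ?thesis unfolding indep_def using assms(11-) by simp
  qed
  moreover have "{a, b, c, d} \<subseteq> {u \<in> V. adj v u}"
    using assms sgraphD(2)[OF graph] by blast
  ultimately show False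
    using K14 sgraphD(1)[OF graph assms(1)] unfolding K14_free_def by blast
qed

text \<open>Adding \<open>xy\<close> and cutting the path from \<open>x\<close> to \<open>y\<close>
  at an edge \<open>pb\<close> next to a branch vertex \<open>p\<close> spoils two leaves and
  creates at most one, namely \<open>b\<close>. The third leaf is what supplies
  \<open>p\<close>.\<close>

lemma leaves_nonadj:
  assumes T: "leaf_minimal V adj T" and lv: "x \<in> leaves V T" "y \<in> leaves V T" "x \<noteq> y"
  shows "\<not> adj x y"
proof
  assume xy: "adj x y"
  note tr = leaf_minimalD(1)[OF T] and sg = leaf_minimalD(2)[OF T] and con = leaf_minimalD(3)[OF T]
  note xV = leafD(1)[OF lv(1)] and yV = leafD(1)[OF lv(2)]
  have le: "T \<le> adj" using T unfolding leaf_minimal_def by blast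
  have fin: "finite (leaves V T)" using finite_leaves[OF sg] .
  have "\<not> leaves V T \<subseteq> {x, y}"
  proof
    assume "leaves V T \<subseteq> {x, y}"
    then have "card (leaves V T) \<le> card {x, y}" by (intro card_mono) auto
    then show False using three_leaves[OF tr le] lv(3) by simp
  qed
  then obtain z where "z \<in> leaves V T" "x \<noteq> z" "y \<noteq> z" by blast
  then obtain p a b where p: "toward T p a x" "toward T p b y" "a \<noteq> b" "deg V T p \<ge> 3"
    using branch_between[OF tr lv(1,2) _ lv(3)] by blast
  note e = towardD(1)[OF p(1)] towardD(1)[OF p(2)]
  have px: "x \<noteq> p" "y \<noteq> p" using toward_neq[OF sg] p by auto
  have nT: "\<not> T x y"
  proof
    assume "T x y"
    then have "avoiding T p x y" using px unfolding avoiding_def by blast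
    then have "toward T p a y"
      by (intro towardI e(1) rtranclp.rtrancl_into_rtrancl[OF towardD(2)[OF p(1)]])
    then show False using toward_unique[OF tr _ p(2)] p(3) by blast
  qed
  have "(del_edge T p b)\<^sup>*\<^sup>* x a" using avoiding_del_edge[OF avoiding_sym[OF sg towardD(2)[OF p(1)]]] .
  moreover have "del_edge T p b a p"
    using e p(3) sgraphD(3,4)[OF sg e(1)] unfolding del_edge_def by auto
  ultimately have "(del_edge T p b)\<^sup>*\<^sup>* x p" by (rule rtranclp.rtrancl_into_rtrancl)
  moreover have "(del_edge T p b)\<^sup>*\<^sup>* y b" using avoiding_del_edge[OF avoiding_sym[OF sg towardD(2)[OF p(2)]]] .
  ultimately have tr': "tree V (swap_edge T p b x y)"
    by (rule exchange[OF tr e(2) xV yV lv(3) nT])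
  have le': "swap_edge T p b x y \<le> adj" by (rule swap_edge_le[OF graph le xy])
  have bx: "b \<noteq> x" using leaf_toward[OF tr p(2) yV] lv by blast
  have "leaves V (swap_edge T p b x y) \<subseteq> insert b (leaves V T - {x, y})"
  proof
    fix c assume c: "c \<in> leaves V (swap_edge T p b x y)"
    have d: "deg V (swap_edge T p b x y) c + of_bool (c = p \<or> c = b) = deg V T c + of_bool (c = x \<or> c = y)"
      by (rule deg_swap_edge[OF sg e(2) xV yV lv(3) nT])
    show "c \<in> insert b (leaves V T - {x, y})"
    proof (cases "c = b \<or> c = p \<or> c = x \<or> c = y")
      case True
      have "c \<noteq> p" using d p(4) px leafD(2)[OF c] by auto
      moreover have "c = b" if "c = x \<or> c = y"
        using that d px leafD(2)[OF c] leafD(2)[OF lv(1)] leafD(2)[OF lv(2)]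
        by (auto simp: of_bool_def split: if_splits)
      ultimately show ?thesis using True by blast
    next
      case False
      then show ?thesis using d c unfolding leaves_def by simp
    qed
  qed
  then have "card (leaves V (swap_edge T p b x y)) \<le> card (insert b (leaves V T - {x, y}))"
    using fin by (intro card_mono) auto
  also have "\<dots> \<le> Suc (card (leaves V T - {x, y}))" using fin by (simp add: card_insert_if)
  also have "card (leaves V T - {x, y}) = card (leaves V T) - 2"
    using lv by (simp add: card_Diff_subset)
  finally show False using leaf_minimal_le[OF T tr' le'] three_leaves[OF tr le] by linarith
qed

text \<open>Replacing the edge \<open>vu\<close> by \<open>vx\<close> makes \<open>u\<close> a leaf instead of \<open>x\<close>; if \<open>u\<close> were a branch
  vertex, a leaf would disappear.\<close>

lemma leaf_swap:
  assumes T: "leaf_minimal V adj T" and x: "x \<in> leaves V T" "adj x v" "toward T v u x" "u \<noteq> x"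
  defines "T1 \<equiv> swap_edge T v u v x"
  shows "deg V T u = 2" "leaf_minimal V adj T1" "leaves V T1 = insert u (leaves V T - {x})"
    "deg V T1 v = deg V T v"
proof -
  note tr = leaf_minimalD(1)[OF T] and sg = leaf_minimalD(2)[OF T] and con = leaf_minimalD(3)[OF T]
  note xV = leafD(1)[OF x(1)] and vu = towardD(1)[OF x(3)]
  note vuV = sgraphD[OF sg vu]
  have le: "T \<le> adj" using T unfolding leaf_minimal_def by blast
  have fin: "finite (leaves V T)" using finite_leaves[OF sg] .
  have vx: "v \<noteq> x" using toward_neq[OF sg x(3)] by blast
  have nT: "\<not> T v x" using toward_to_nbr[OF tr x(3)] x(4) by blast
  have tr1: "tree V T1"
    unfolding T1_def
    by (rule exchange[OF tr vu vuV(1) xV vx nT rtranclp.rtrancl_refl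
          avoiding_del_edge[OF avoiding_sym[OF sg towardD(2)[OF x(3)]]]])
  have le1: "T1 \<le> adj" unfolding T1_def by (rule swap_edge_le[OF graph le adj_sym[OF x(2)]])
  have d: "deg V T1 c + of_bool (c = v \<or> c = u) = deg V T c + of_bool (c = v \<or> c = x)" for c
    unfolding T1_def by (rule deg_swap_edge[OF sg vu vuV(1) xV vx nT])
  have u2: "deg V T u \<ge> 2" using toward_deg_ge2[OF tr x(3) xV x(4)] .
  show "deg V T1 v = deg V T v" using d[of v] by simp
  have dx: "deg V T1 x = 2" using d[of x] leafD(2)[OF x(1)] vx x(4) by auto
  have du: "Suc (deg V T1 u) = deg V T u" using d[of u] vuV(3) x(4) by auto
  have oth: "deg V T1 c = deg V T c" if "c \<noteq> x" "c \<noteq> u" for c using d[of c] that by auto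
  show eq2: "deg V T u = 2"
  proof (rule ccontr)
    assume "deg V T u \<noteq> 2"
    then have "deg V T1 u \<ge> 2" using u2 du by auto
    have "leaves V T1 \<subseteq> leaves V T - {x}"
    proof
      fix c assume c: "c \<in> leaves V T1"
      then have "c \<noteq> x" "c \<noteq> u" using dx \<open>deg V T1 u \<ge> 2\<close> leafD(2)[OF c] by auto
      then show "c \<in> leaves V T - {x}" using c oth[of c] unfolding leaves_def by auto
    qed
    then have "card (leaves V T1) \<le> card (leaves V T - {x})" using fin by (intro card_mono) auto
    also have "\<dots> < card (leaves V T)" using fin x(1) by (rule card_Diff1_less)
    finally show False using leaf_minimal_le[OF T tr1 le1] by simp
  qed
  show lv: "leaves V T1 = insert u (leaves V T - {x})"
  proof (intro set_eqI)
    fix c show "c \<in> leaves V T1 \<longleftrightarrow> c \<in> insert u (leaves V T - {x})"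
      using eq2 dx du oth[of c] vuV(2) x(4) by (cases "c = x"; cases "c = u") (auto simp: leaves_def)
  qed
  show "leaf_minimal V adj T1"
    using leaf_minimalI[OF T tr1 le1 leaves_subset_card[OF fin _ x(1)]] lv by blast
qed

text \<open>After the exchange in \<open>leaf_swap\<close>, both \<open>u\<close> and
  \<open>y\<close> are leaves of a tree with the fewest leaves.\<close>

lemma leaf_nbr_toward:
  assumes T: "leaf_minimal V adj T" and x: "x \<in> leaves V T" "adj x v" "toward T v u x"
  shows "deg V T u \<le> 2" "y \<in> leaves V T \<Longrightarrow> y \<noteq> x \<Longrightarrow> \<not> adj u y"
proof -
  show "deg V T u \<le> 2"
    using leaf_swap(1)[OF T x] leafD(2)[OF x(1)] by (cases "u = x") auto
  assume y: "y \<in> leaves V T" "y \<noteq> x"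
  show "\<not> adj u y"
  proof (cases "u = x")
    case True
    then show ?thesis using leaves_nonadj[OF T x(1) y(1)] y(2) by blast
  next
    case False
    note s = leaf_swap[OF T x False]
    have "u \<noteq> y" using s(1) leafD(2)[OF y(1)] by auto
    then show ?thesis using leaves_nonadj[OF s(2), of u y] s(3) y by blast
  qed
qed

text \<open>In the exchanged tree \<open>T1\<close> the path from \<open>p\<close> to the leaf
  \<open>u\<close> starts with \<open>v\<close>. If \<open>u\<close> were adjacent to
  \<open>p\<close>, then \<open>v\<close> would have degree at most two and no adjacent leaf besides
  \<open>u\<close>, against \<open>vy\<close>.\<close>

lemma nbr_nonadj_toward:
  assumes T: "leaf_minimal V adj T" and x: "x \<in> leaves V T" "adj x v" "toward T v u x" "u \<noteq> x"
    and p: "T v p" "p \<noteq> u"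
    and vy: "deg V T v \<ge> 3 \<or> (\<exists>y\<in>leaves V T. y \<noteq> x \<and> adj v y)"
  shows "\<not> adj u p"
proof
  assume up: "adj u p"
  note tr = leaf_minimalD(1)[OF T] and sg = leaf_minimalD(2)[OF T]
  define T1 where "T1 = swap_edge T v u v x"
  note s = leaf_swap[OF T x, folded T1_def]
  note vu = towardD(1)[OF x(3)] and ux = towardD(2)[OF x(3)]
  have px: "p \<noteq> x" using toward_to_nbr[OF tr x(3)] p x(4) by blast
  have pv: "p \<noteq> v" using sgraphD(3)[OF sg p(1)] by blast
  have vx: "v \<noteq> x" using toward_neq[OF sg x(3)] by blast
  have ne: "z \<noteq> p" if "(avoiding T v)\<^sup>*\<^sup>* u z" for z
    using toward_to_nbr[OF tr towardI[of T v u z]] vu that p by auto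
  \<comment> \<open>The old path from \<open>u\<close> to \<open>x\<close> avoids both
    \<open>v\<close> and \<open>p\<close>, so it survives the exchange; the new edge
    \<open>vx\<close> attaches it to \<open>v\<close>.\<close>
  have path: "(avoiding T1 p)\<^sup>*\<^sup>* u z" if "(avoiding T v)\<^sup>*\<^sup>* u z" for z
    using that
  proof induct
    case (step z z')
    have "z' \<noteq> p" by (rule ne[OF rtranclp.rtrancl_into_rtrancl[OF step(1,2)]])
    then have "avoiding T1 p z z'"
      using ne[OF step(1)] step(2) unfolding avoiding_def T1_def swap_edge_def del_edge_def by auto
    with step(3) show ?case by (rule rtranclp.rtrancl_into_rtrancl)
  qed simp
  have "avoiding T1 p v x" using px pv unfolding avoiding_def T1_def swap_edge_def by auto
  then have "(avoiding T1 p)\<^sup>*\<^sup>* v u"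
    using avoiding_sym[OF leaf_minimalD(2)[OF s(2)] path[OF ux]] by (rule converse_rtranclp_into_rtranclp)
  moreover have "T1 p v"
    using sgraphD(4)[OF sg p(1)] p pv sgraphD(3)[OF sg vu] unfolding T1_def swap_edge_def del_edge_def by auto
  ultimately have d: "toward T1 p v u" by (intro towardI)
  have uL: "u \<in> leaves V T1" using s(3) by blast
  show False
    using vy
  proof
    assume "deg V T v \<ge> 3"
    then show False using leaf_nbr_toward(1)[OF s(2) uL up d] s(4) by simp
  next
    assume "\<exists>y\<in>leaves V T. y \<noteq> x \<and> adj v y"
    then obtain y where y: "y \<in> leaves V T" "y \<noteq> x" "adj v y" by blast
    have "y \<noteq> u" using s(1) leafD(2)[OF y(1)] by auto
    then show False using leaf_nbr_toward(2)[OF s(2) uL up d, of y] s(3) y by blast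
  qed
qed

text \<open>Otherwise \<open>x\<close>, \<open>y\<close>, \<open>u\<close> and another tree
  neighbour \<open>p\<close> of \<open>v\<close> form an induced star at \<open>v\<close>; such a
  \<open>p\<close> exists because \<open>v\<close>, being adjacent to a leaf, is no leaf. Hence no
  edge is charged twice from the same side.\<close>

lemma leaf_dirs_distinct:
  assumes T: "leaf_minimal V adj T" and x: "x \<in> leaves V T" "adj x v" "toward T v u x"
    and y: "y \<in> leaves V T" "adj y v" "toward T v u y"
  shows "x = y"
proof (rule ccontr)
  assume xy: "x \<noteq> y"
  note tr = leaf_minimalD(1)[OF T] and sg = leaf_minimalD(2)[OF T]
  note xV = leafD(1)[OF x(1)] and yV = leafD(1)[OF y(1)] and vu = towardD(1)[OF x(3)]
  have ux: "u \<noteq> x" using leaf_toward[OF tr y(3) yV] x(1) xy by blast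
  have uy: "u \<noteq> y" using leaf_toward[OF tr x(3) xV] y(1) xy by blast
  have "v \<notin> leaves V T" using leaves_nonadj[OF T x(1)] x(2) toward_neq[OF sg x(3)] by blast
  then have "deg V T v \<ge> 2"
    using deg_ge1[OF sg vu] sgraphD(1)[OF sg vu] unfolding leaves_def by auto
  then obtain p where p: "T v p" "p \<noteq> u" by (rule deg_obtain_other)
  have px: "p \<noteq> x" using toward_to_nbr[OF tr x(3)] p ux by blast
  have py: "p \<noteq> y" using toward_to_nbr[OF tr y(3)] p uy by blast
  have sym: "adj a b \<longleftrightarrow> adj b a" for a b using adj_sym by blast
  have "\<not> adj p x"
  proof
    assume "adj p x"
    then show False
      using leaf_nbr_toward(2)[OF T x(1) _ toward_flip[OF tr x(3) p] y(1)] y(2) xy sym[of x p] sym[of v y] by simp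
  qed
  moreover have "\<not> adj p y"
  proof
    assume "adj p y"
    then show False
      using leaf_nbr_toward(2)[OF T y(1) _ toward_flip[OF tr y(3) p] x(1)] x(2) xy sym[of y p] sym[of v x] by simp
  qed
  moreover have "\<not> adj u p"
    by (rule nbr_nonadj_toward[OF T x ux p]) (use y xy sym[of v y] in auto)
  moreover have "\<not> adj u y" by (rule leaf_nbr_toward(2)[OF T x y(1)]) (use xy in simp)
  moreover have "\<not> adj u x" by (rule leaf_nbr_toward(2)[OF T y x(1) xy])
  moreover have "\<not> adj x y" using leaves_nonadj[OF T x(1) y(1) xy] .
  ultimately show False
    using no_K14[of v x y u p] sym[of v x] sym[of v y] sym[of x u] sym[of x p] sym[of y u] sym[of y p]
      leaf_minimalD(4)[OF T vu] leaf_minimalD(4)[OF T p(1)] x(2) y(2) xy ux uy px py p(2) by simp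
qed

end

section \<open>A deepest rooted tree\<close>

definition deepest :: "'a set \<Rightarrow> ('a \<Rightarrow> 'a \<Rightarrow> bool) \<Rightarrow> ('a \<Rightarrow> 'a \<Rightarrow> bool) \<Rightarrow> 'a \<Rightarrow> bool" where
  "deepest V adj T r \<longleftrightarrow> leaf_minimal V adj T \<and> r \<in> leaves V T \<and>
     (\<forall>T' r'. leaf_minimal V adj T' \<longrightarrow> r' \<in> leaves V T' \<longrightarrow>
        (\<Sum>v\<in>V. gdist T' r' v) \<le> (\<Sum>v\<in>V. gdist T r v))"

lemma finite_subgraphs:
  assumes "finite V"
  shows "finite {T. \<forall>u v. T u v \<longrightarrow> u \<in> V \<and> v \<in> V}"
proof (rule finite_subset)
  show "{T. \<forall>u v. T u v \<longrightarrow> u \<in> V \<and> v \<in> V} \<subseteq> (\<lambda>E u v. (u, v) \<in> E) ` Pow (V \<times> V)"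
  proof
    fix T assume "T \<in> {T. \<forall>u v. T u v \<longrightarrow> u \<in> V \<and> v \<in> V}"
    then have "{(u, v). T u v} \<in> Pow (V \<times> V)" by auto
    then show "T \<in> (\<lambda>E u v. (u, v) \<in> E) ` Pow (V \<times> V)"
      by (rule rev_image_eqI) simp
  qed
qed (use assms in simp)

lemma leaf_minimal_exists:
  assumes "sgraph V adj" "gconnected V adj"
  shows "\<exists>T. leaf_minimal V adj T"
proof -
  obtain T0 where "tree V T0 \<and> T0 \<le> adj" using tree_exists[OF assms] by blast
  from ex_has_least_nat[of "\<lambda>T. tree V T \<and> T \<le> adj", OF this, of "\<lambda>T. card (leaves V T)"]
  show ?thesis unfolding leaf_minimal_def by blast
qed

lemma deepest_exists:
  assumes "leaf_minimal V adj T0" "r0 \<in> leaves V T0"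
  shows "\<exists>T r. deepest V adj T r"
proof -
  let ?P = "\<lambda>p. leaf_minimal V adj (fst p) \<and> snd p \<in> leaves V (fst p)"
  let ?f = "\<lambda>p. \<Sum>v\<in>V. gdist (fst p) (snd p) v"
  have fV: "finite V" using leaf_minimalD(2)[OF assms(1)] sgraph_finite by blast
  have "{p. ?P p} \<subseteq> {T. \<forall>u v. T u v \<longrightarrow> u \<in> V \<and> v \<in> V} \<times> V"
  proof
    fix p assume "p \<in> {p. ?P p}"
    then have p: "leaf_minimal V adj (fst p)" "snd p \<in> leaves V (fst p)" by auto
    show "p \<in> {T. \<forall>u v. T u v \<longrightarrow> u \<in> V \<and> v \<in> V} \<times> V"
      using sgraphD(1,2)[OF leaf_minimalD(2)[OF p(1)]] leafD(1)[OF p(2)] by (cases p) auto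
  qed
  then have fin: "finite {p. ?P p}"
    by (rule finite_subset) (use finite_subgraphs[OF fV] fV in simp)
  \<comment> \<open>\<open>ex_has_greatest_nat\<close> asks for a strict bound, hence the
    \<open>Suc\<close>.\<close>
  have "\<forall>p. ?P p \<longrightarrow> ?f p < Suc (Max (?f ` {p. ?P p}))"
  proof (intro allI impI)
    fix q assume "?P q"
    then have "?f q \<in> ?f ` {p. ?P p}" by (intro imageI) simp
    from Max_ge[OF finite_imageI[OF fin] this] show "?f q < Suc (Max (?f ` {p. ?P p}))" by simp
  qed
  moreover have "?P (T0, r0)" using assms by simp
  ultimately obtain p where "?P p" "\<forall>q. ?P q \<longrightarrow> ?f q \<le> ?f p"
    using ex_has_greatest_nat[of ?P "(T0, r0)" ?f] by blast
  then have "deepest V adj (fst p) (snd p)" unfolding deepest_def by auto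
  then show ?thesis by blast
qed

text \<open>\<open>chain V T r w c\<close>: climbing from \<open>w\<close> towards the root \<open>r\<close>, \<open>c\<close> is met before any further
  branch vertex.\<close>

inductive chain :: "'a set \<Rightarrow> ('a \<Rightarrow> 'a \<Rightarrow> bool) \<Rightarrow> 'a \<Rightarrow> 'a \<Rightarrow> 'a \<Rightarrow> bool" for V T r w where
  base: "chain V T r w w"
| up: "\<lbrakk>chain V T r w c; c \<noteq> r; deg V T (parent T r c) \<le> 2\<rbrakk> \<Longrightarrow> chain V T r w (parent T r c)"

locale deep_tree = three_leaf_host +
  fixes T :: "'a \<Rightarrow> 'a \<Rightarrow> bool" and r :: 'a and S :: "'a set"
  assumes deep: "deepest V adj T r" and S: "S \<subseteq> leaves V T" "r \<in> S"
begin

lemma leaf_minimal: "leaf_minimal V adj T" and r_leaf: "r \<in> leaves V T"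
  using deep unfolding deepest_def by auto

lemmas tr = leaf_minimalD(1)[OF leaf_minimal] and sg = leaf_minimalD(2)[OF leaf_minimal] and con = leaf_minimalD(3)[OF leaf_minimal]
lemmas rV = leafD(1)[OF r_leaf]
lemmas T_adj = leaf_minimalD(4)[OF leaf_minimal]
lemmas st = parent_step[OF con sg rV]

abbreviation "p \<equiv> parent T r"
abbreviation "depth \<equiv> gdist T r"

text \<open>Otherwise hanging the subtree of \<open>b\<close> below \<open>a\<close> would increase the total depth.\<close>

lemma siblings_nonadj:
  assumes w: "w \<noteq> r" "deg V T w \<ge> 3" and ab: "T w a" "T w b" "a \<noteq> b" "a \<noteq> p w" "b \<noteq> p w"
  shows "\<not> adj a b"
proof
  assume adj: "adj a b"
  note sgw = sgraphD[OF sg ab(1)] sgraphD[OF sg ab(2)]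
  note ca = child[OF tr rV ab(1) disjI2[OF ab(4)]] and cb = child[OF tr rV ab(2) disjI2[OF ab(5)]]
  have nT: "\<not> T a b" using edge_parent[OF tr rV, of a b] ca cb sgw by auto
  let ?T = "swap_edge T w b a b"
  have "del_edge T w b a w" using sgw ab unfolding del_edge_def by auto
  then have tr': "tree V ?T"
    by (intro exchange[OF tr ab(2) sgw(2) sgw(6) ab(3) nT]) auto
  have le: "T \<le> adj" using leaf_minimal unfolding leaf_minimal_def by blast
  have le': "?T \<le> adj" by (rule swap_edge_le[OF graph le adj])
  have d: "deg V ?T c + of_bool (c = w \<or> c = b) = deg V T c + of_bool (c = a \<or> c = b)" for c
    by (rule deg_swap_edge[OF sg ab(2) sgw(2) sgw(6) ab(3) nT])
  \<comment> \<open>The vertex \<open>w\<close> keeps degree at least two, \<open>a\<close> gains a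
    neighbour and \<open>b\<close> trades one for another, so no leaf arises.\<close>
  have "leaves V ?T \<subseteq> leaves V T"
  proof
    fix c assume c: "c \<in> leaves V ?T"
    have "deg V T a \<ge> 1" using deg_ge1[OF sg sgw(4)] .
    then have "c \<noteq> w" "c \<noteq> a" using d[of c] leafD(2)[OF c] w(2) ab sgw by auto
    then show "c \<in> leaves V T" using d[of c] c unfolding leaves_def by auto
  qed
  then have leaf_minimal': "leaf_minimal V adj ?T"
    using leaf_minimalI[OF leaf_minimal tr' le'] card_mono[OF finite_leaves[OF sg]] by blast
  have ra: "r \<noteq> a" "r \<noteq> b" using ca cb by auto
  have r': "r \<in> leaves V ?T"
    using d[of r] r_leaf w(1) ra unfolding leaves_def by auto
  note sg' = leaf_minimalD(2)[OF leaf_minimal'] and con' = leaf_minimalD(3)[OF leaf_minimal']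
  have step: "depth y \<le> Suc (depth x)" if "?T x y" for x y
  proof (cases "T x y")
    case True
    then show ?thesis using gdist_edge[OF con rV sgraphD(1)[OF sg True]] by blast
  next
    case False
    then show ?thesis using that ca cb unfolding swap_edge_def del_edge_def by auto
  qed
  have ge: "depth v \<le> gdist ?T r v" if "v \<in> V" for v
    by (rule gdist_ge[of V ?T r v depth, OF con' rV that gdist_self step])
  let ?x = "parent ?T r b"
  have x: "?T b ?x" "gdist ?T r b = Suc (gdist ?T r ?x)" "?x \<in> V"
    using parent_step[OF con' sg' rV sgw(6)] cb by auto
  \<comment> \<open>Whichever neighbour is the new parent of \<open>b\<close>, the sibling
    \<open>a\<close> or an old child, its old depth is at least that of \<open>b\<close>. As no
    depth drops, \<open>b\<close> gets strictly deeper.\<close>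
  have "depth b \<le> depth ?x"
  proof (cases "?x = a")
    case True
    then show ?thesis using ca cb by simp
  next
    case False
    then have "T b ?x" "?x \<noteq> w" using x(1) ab(3) unfolding swap_edge_def del_edge_def by auto
    then show ?thesis using child(3)[OF tr rV, of b ?x] cb by auto
  qed
  then have "depth b < gdist ?T r b" using ge[OF x(3)] x(2) by simp
  then have "(\<Sum>v\<in>V. depth v) < (\<Sum>v\<in>V. gdist ?T r v)"
    using sum_strict_mono_ex1[of V depth "gdist ?T r"] sgraph_finite[OF sg] ge sgw(6) by blast
  then show False using deep leaf_minimal' r' unfolding deepest_def by (meson not_less)
qed

section \<open>Segments between consecutive branch vertices\<close>

lemma inner_deg:
  assumes "c \<in> V" "c \<noteq> r" "p c \<noteq> r"
  shows "deg V T (p c) \<ge> 2"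
proof (rule deg_ge2[OF sg])
  show "T (p c) c" using st(1)[OF assms(1,2)] sgraphD(4)[OF sg] by blast
  show "T (p c) (p (p c))" using st(1)[OF st(3)[OF assms(1,2)] assms(3)] .
  show "c \<noteq> p (p c)" using st(2)[OF assms(1,2)] st(2)[OF st(3)[OF assms(1,2)] assms(3)] by auto
qed

lemma chain_V: "chain V T r w c \<Longrightarrow> w \<in> V \<Longrightarrow> c \<in> V"
  by (induct rule: chain.induct) (auto intro: st(3))

lemma chain_depth: "chain V T r w c \<Longrightarrow> w \<in> V \<Longrightarrow> c = w \<or> depth c < depth w"
proof (induct rule: chain.induct)
  case (up c)
  then show ?case using st(2)[OF chain_V[OF up(1) up(5)] up(3)] by auto
qed simp

text \<open>Keeps the edges assigned to branch vertices apart from the pendant edges of leaves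
  outside \<open>S\<close>.\<close>

lemma chain_deg:
  assumes "chain V T r w c" "w \<in> branches V T" "c \<noteq> r"
  shows "deg V T c \<ge> 2"
  using assms(1)
proof cases
  case base
  then show ?thesis using assms(2) unfolding branches_def by simp
next
  case (up c')
  then show ?thesis using inner_deg[of c'] chain_V[of w c'] assms unfolding branches_def by auto
qed

text \<open>The root is a leaf, and any other vertex spends one of its at most two neighbours on its
  own parent.\<close>

lemma child_unique:
  assumes "c \<in> V" "c \<noteq> r" "d \<in> V" "d \<noteq> r" "p c = p d" "deg V T (p c) \<le> 2"
  shows "c = d"
proof (rule ccontr)
  assume ne: "c \<noteq> d"
  have e: "T (p c) c" "T (p c) d" using st(1) assms sgraphD(4)[OF sg] by metis+
  show False
  proof (cases "p c = r")
    case True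
    then show False using leaf_nbr_unique[OF sg r_leaf] e ne by auto
  next
    case False
    note pp = st(3)[OF assms(1,2)]
    have "depth c = Suc (depth (p c))" "depth d = Suc (depth (p c))" "depth (p c) = Suc (depth (p (p c)))"
      using st(2)[OF assms(1,2)] st(2)[OF assms(3,4)] st(2)[OF pp False] assms(5) by auto
    then have "c \<noteq> p (p c)" "d \<noteq> p (p c)" by auto
    then show False using deg_ge3[OF sg e st(1)[OF pp False] ne] assms(6) by simp
  qed
qed

text \<open>Descending from \<open>c\<close>, each vertex before the first branch vertex has one
  child, so that branch vertex is determined. Hence different branch vertices receive different
  uncharged edges.\<close>

lemma chain_inj:
  assumes "chain V T r w c" "chain V T r w' c" "w \<in> branches V T" "w' \<in> branches V T"
  shows "w = w'"
  using assms
proof (induct rule: chain.induct)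
  case base
  from base(1) show ?case by cases (use base(2) in \<open>auto simp: branches_def\<close>)
next
  case (up c)
  note IH = up(2) and cr = up(1,3,4)
  from up(5) show ?case
  proof cases
    case base
    then show ?thesis using up(4,7) by (auto simp: branches_def)
  next
    case (up d)
    have "c = d"
      by (rule child_unique)
        (use up cr chain_V assms(3,4) in \<open>auto simp: branches_def\<close>)
    then show ?thesis using IH up assms(3,4) by blast
  qed
qed

lemma chain_top:
  assumes "w \<in> V"
  shows "\<exists>c. chain V T r w c \<and> (c = r \<or> deg V T (p c) \<ge> 3)"
proof -
  have *: "chain V T r w c \<Longrightarrow> ?thesis" for c
  proof (induct "depth c" arbitrary: c rule: less_induct)
    case less
    show ?case
    proof (cases "c = r \<or> deg V T (p c) \<ge> 3")
      case False
      then have "chain V T r w (p c)" using less(2) by (intro chain.up) auto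
      moreover have "depth (p c) < depth c" using st(2)[of c] False chain_V[OF less(2) assms] by simp
      ultimately show ?thesis using less(1) by blast
    qed (use less(2) in blast)
  qed
  show ?thesis by (rule *[OF chain.base])
qed

text \<open>The vertices of the segment strictly above \<open>w\<close> and below the root are no
  leaves and have one child each, so a leaf below \<open>c\<close> lies below
  \<open>w\<close>.\<close>

lemma chain_down:
  assumes "chain V T r w c" "w \<in> branches V T" "c \<noteq> r" "toward T (p c) c y" "y \<in> leaves V T"
  shows "toward T (p w) w y"
  using assms
proof (induct rule: chain.induct)
  case (up c)
  have cV: "c \<in> V" using chain_V[OF up(1)] up(5) unfolding branches_def by blast
  note pV = st(3)[OF cV up(3)] and e = st(1)[OF cV up(3)]
  have "p c \<noteq> y" using inner_deg[OF cV up(3,6)] leafD(2)[OF up(8)] by auto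
  then obtain z where z: "toward T (p c) z y" "z \<noteq> p (p c)"
    using toward_next[OF tr up(7) leafD(1)[OF up(8)]] by blast
  note cz = child[OF tr rV towardD(1)[OF z(1)] disjI2[OF z(2)]]
  have "z = c"
    by (rule child_unique) (use cz cV up(3,4) sgraphD(2)[OF sg towardD(1)[OF z(1)]] in auto)
  then show ?case using up(2)[OF up(5,3)] z(1) up(8) by blast
qed

text \<open>All vertices climbed are less deep than \<open>w\<close>. This puts \<open>p c\<close>
  on the upper side of the edge from \<open>w\<close> to \<open>p w\<close>, as the exchange in
  \<open>chain_unused\<close> requires.\<close>

lemma chain_up_path:
  assumes "chain V T r w c" "w \<in> V" "c \<noteq> r" "w \<noteq> r"
  shows "(avoiding T w)\<^sup>*\<^sup>* (p w) (p c)"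
  using assms
proof (induct rule: chain.induct)
  case (up c)
  have cV: "c \<in> V" using chain_V[OF up(1,5)] .
  note pV = st(3)[OF cV up(3)]
  have "depth (p c) < depth w" "depth (p (p c)) < depth w"
    using chain_depth[OF up(1,5)] st(2)[OF cV up(3)] st(2)[OF pV up(6)] by auto
  then have "avoiding T w (p c) (p (p c))" using st(1)[OF pV up(6)] unfolding avoiding_def by auto
  with up(2)[OF up(5,3,7)] show ?case by (rule rtranclp.rtrancl_into_rtrancl)
qed simp

text \<open>The adjacency \<open>xv\<close> of a leaf \<open>x \<in> S\<close> is charged to the tree edge leaving \<open>v\<close> towards \<open>x\<close>. The
  set \<open>K\<close> represents each charged edge by its end farther from the root.\<close>

definition used :: "'a \<Rightarrow> 'a \<Rightarrow> bool" where
  "used v u \<longleftrightarrow> (\<exists>x\<in>S. adj x v \<and> toward T v u x)"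

definition K :: "'a set" where
  "K = {c \<in> V. c \<noteq> r \<and> (used c (p c) \<or> used (p c) c)}"

lemma used_deg: "used v u \<Longrightarrow> deg V T u \<le> 2"
  unfolding used_def using leaf_nbr_toward(1)[OF leaf_minimal] S(1) by blast

text \<open>The leaves \<open>x\<close> and \<open>y\<close> differ, and \<open>u\<close> is
  adjacent to no leaf other than \<open>x\<close>. Hence no edge is charged from both sides.\<close>

lemma used_antisym:
  assumes "x \<in> S" "adj x v" "toward T v u x" "y \<in> S" "adj y u" "toward T u v y"
  shows False
proof -
  have "x \<noteq> y" using toward_antisym[OF tr assms(3)] assms(6) by blast
  then show False
    using leaf_nbr_toward(2)[OF leaf_minimal _ assms(2,3), of y] assms S(1) adj_sym[OF assms(5)] by blast
qed

text \<open>Of the two end edges of the segment above a branch vertex at most one is charged. If both are,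
  by \<open>x\<close> from above and by \<open>y\<close> from below, then \<open>K\<^sub>1\<^sub>,\<^sub>4\<close>-freeness at \<open>w\<close> makes \<open>x\<close> adjacent to the
  parent \<open>q\<close> of \<open>w\<close>, but \<open>y\<close> can be reattached so that \<open>q\<close> becomes a leaf in its place.\<close>

lemma chain_unused:
  assumes w: "w \<in> branches V T" and c: "chain V T r w c" "c \<noteq> r" "deg V T (p c) \<ge> 3"
    and K: "w \<in> K" "c \<in> K"
  shows False
proof -
  have wV: "w \<in> V" "deg V T w \<ge> 3" using w unfolding branches_def by auto
  have wr: "w \<noteq> r" using K unfolding K_def by blast
  let ?q = "p w"
  have "\<not> used ?q w" using used_deg[of ?q w] wV by auto
  then have "used w ?q" using K unfolding K_def by blast
  then obtain x where x: "x \<in> S" "adj x w" "toward T w ?q x" unfolding used_def by blast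
  have xL: "x \<in> leaves V T" using x(1) S by blast
  have qdeg: "deg V T ?q \<le> 2" using leaf_nbr_toward(1)[OF leaf_minimal xL x(2,3)] .
  \<comment> \<open>The charge at \<open>w\<close> bounds the degree of \<open>?q\<close>, so
    \<open>?q\<close> is not the branch vertex \<open>p c\<close> and the two end edges of the
    segment differ.\<close>
  have cw: "c \<noteq> w" using qdeg c(3) by auto
  then have dc: "depth c < depth w" using chain_depth[OF c(1) wV(1)] by blast
  have cV: "c \<in> V" using chain_V[OF c(1) wV(1)] .
  have qr: "?q \<noteq> r"
  proof
    assume "?q = r"
    then have "depth c = 0" using st(2)[OF wV(1) wr] dc by simp
    then show False using gdist_eq_0[OF con rV cV] c(2) by blast
  qed
  have q2: "deg V T ?q = 2" using inner_deg[OF wV(1) wr qr] qdeg by simp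
  have qx: "?q \<noteq> x" using q2 leafD(2)[OF xL] by auto
  note wq = st(1)[OF wV(1) wr] and qV = st(3)[OF wV(1) wr]
  have "\<not> used c (p c)" using used_deg[of c "p c"] c(3) by auto
  then have "used (p c) c" using K unfolding K_def by blast
  then obtain y where y: "y \<in> S" "adj y (p c)" "toward T (p c) c y" unfolding used_def by blast
  have yL: "y \<in> leaves V T" using y(1) S by blast
  have qy: "toward T ?q w y" by (rule chain_down[OF c(1) w c(2) y(3) yL])
  have xy: "x \<noteq> y" using toward_antisym[OF tr x(3)] qy by blast
  have "adj x ?q"
  proof (rule ccontr)
    assume nx: "\<not> adj x ?q"
    obtain a b where ab: "T w a" "T w b" "a \<noteq> ?q" "b \<noteq> ?q" "a \<noteq> b"
      using deg_obtain_others[OF wV(2), of ?q] by metis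
    have *: "u \<noteq> x" "\<not> adj x u" "\<not> adj ?q u" if u: "T w u" "u \<noteq> ?q" for u
    proof -
      show "u \<noteq> x" using toward_to_nbr[OF tr x(3)] u qx by blast
      \<comment> \<open>Seen from \<open>u\<close>, the path to \<open>x\<close> starts with
        \<open>w\<close>; an edge \<open>xu\<close> would limit the degree of \<open>w\<close> to
        two.\<close>
      show "\<not> adj x u"
        using leaf_nbr_toward(1)[OF leaf_minimal xL _ toward_flip[OF tr x(3) u]] wV(2) by fastforce
      show "\<not> adj ?q u" by (rule nbr_nonadj_toward[OF leaf_minimal xL x(2,3) qx u]) (use wV(2) in simp)
    qed
    have "\<not> adj a b" by (rule siblings_nonadj[OF wr wV(2) ab(1,2,5,3,4)])
    then show False
      using no_K14[of w x ?q a b] adj_sym[OF x(2)] T_adj[OF wq] T_adj[OF ab(1)] T_adj[OF ab(2)]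
        nx *[OF ab(1,3)] *[OF ab(2,4)] ab qx by simp
  qed
  note pcV = st(3)[OF cV c(2)]
  have ypc: "y \<noteq> p c" using toward_neq[OF sg y(3)] .
  have nT: "\<not> T (p c) y"
    using toward_to_nbr[OF tr y(3)] chain_deg[OF c(1) w c(2)] leafD(2)[OF yL] by fastforce
  have qw: "T ?q w" using sgraphD(4)[OF sg wq] .
  have pq: "(del_edge T ?q w)\<^sup>*\<^sup>* (p c) ?q"
    using avoiding_del_edge[OF avoiding_sym[OF sg chain_up_path[OF c(1) wV(1) c(2) wr]], of ?q]
    unfolding del_edge_commute[of T ?q w] .
  \<comment> \<open>Without the edge from \<open>?q\<close> to \<open>w\<close>, the leaf
    \<open>y\<close> is on the side of \<open>w\<close> and \<open>p c\<close> on the side of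
    \<open>?q\<close>. The exchange lowers \<open>?q\<close> to degree one, while \<open>w\<close>
    keeps at least two and \<open>y\<close> gets two.\<close>
  let ?T = "swap_edge T ?q w (p c) y"
  have tr': "tree V ?T"
    by (rule exchange[OF tr qw pcV leafD(1)[OF yL] ypc[symmetric] nT pq
          avoiding_del_edge[OF avoiding_sym[OF sg towardD(2)[OF qy]]]])
  have le: "T \<le> adj" using leaf_minimal unfolding leaf_minimal_def by blast
  have le': "?T \<le> adj" by (rule swap_edge_le[OF graph le adj_sym[OF y(2)]])
  have d: "deg V ?T v + of_bool (v = ?q \<or> v = w) = deg V T v + of_bool (v = p c \<or> v = y)" for v
    by (rule deg_swap_edge[OF sg qw pcV leafD(1)[OF yL] ypc[symmetric] nT])
  have yq: "y \<noteq> ?q" "y \<noteq> w" using toward_neq[OF sg qy] leafD(2)[OF yL] wV(2) by auto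
  have qc: "?q \<noteq> p c" using q2 c(3) by auto
  have "leaves V ?T \<subseteq> insert ?q (leaves V T - {y})"
  proof
    fix v assume v: "v \<in> leaves V ?T"
    show "v \<in> insert ?q (leaves V T - {y})"
    proof (cases "v = ?q")
      case False
      have "v \<noteq> y" using d[of y] yq leafD(2)[OF v] leafD(2)[OF yL] by auto
      moreover have "v \<noteq> w" using d[of w] leafD(2)[OF v] wV(2) by auto
      moreover have "v \<noteq> p c" using d[of v] False leafD(2)[OF v] c(3) \<open>v \<noteq> w\<close> by auto
      ultimately show ?thesis using d[of v] v False unfolding leaves_def by auto
    qed simp
  qed
  then have m: "leaf_minimal V adj ?T"
    using leaf_minimalI[OF leaf_minimal tr' le' leaves_subset_card[OF finite_leaves[OF sg] _ yL]] by blast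
  have "?q \<in> leaves V ?T" using d[of ?q] yq(1) qc q2 qV unfolding leaves_def by auto
  moreover have "x \<in> leaves V ?T"
  proof -
    have "x \<noteq> w" "x \<noteq> p c" using leafD(2)[OF xL] wV(2) c(3) by auto
    then show ?thesis using d[of x] qx xy xL unfolding leaves_def by auto
  qed
  ultimately show False using leaves_nonadj[OF m _ _ qx[symmetric]] \<open>adj x ?q\<close> by blast
qed

section \<open>Counting charged and uncharged edges\<close>

lemma branch_unused_edge:
  assumes w: "w \<in> branches V T"
  shows "\<exists>c. chain V T r w c \<and> c \<notin> K"
proof -
  have "w \<in> V" using w unfolding branches_def by blast
  then obtain c where c: "chain V T r w c" "c = r \<or> deg V T (p c) \<ge> 3" using chain_top by blast
  have "r \<notin> K" unfolding K_def by simp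
  then have "w \<notin> K \<or> c \<notin> K" using chain_unused[OF w c(1)] c(2) by auto
  then show ?thesis using c(1) chain.base[of V T r w] by auto
qed

text \<open>Two adjacencies with the same image are charged to the same tree edge:
  \<open>leaf_dirs_distinct\<close> settles equal orientations, \<open>used_antisym\<close> opposite
  ones.\<close>

lemma card_adjacencies: "(\<Sum>x\<in>S. deg V adj x) \<le> card K"
proof -
  have finV: "finite V" using sgraph_finite[OF sg] .
  have finS: "finite S" using finite_subset[OF S(1) finite_leaves[OF sg]] .
  let ?I = "SIGMA x:S. {v \<in> V. adj x v}"
  let ?R = "\<lambda>i c. c \<in> K \<and> (\<exists>u. toward T (snd i) u (fst i) \<and>
    ((snd i = c \<and> u = p c) \<or> (snd i = p c \<and> u = c)))"
  have ex: "\<exists>c. ?R i c" if "i \<in> ?I" for i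
  proof -
    obtain x v where iv: "i = (x, v)" by (cases i)
    then have i: "i = (x, v)" "x \<in> S" "v \<in> V" "adj x v" using that by auto
    have xL: "x \<in> leaves V T" using i S by blast
    have "x \<noteq> v" using sgraphD(3)[OF graph i(4)] .
    then obtain u where u: "toward T v u x" using toward_exists[OF con leafD(1)[OF xL] i(3)] by blast
    have us: "used v u" unfolding used_def using u i by blast
    have uV: "u \<in> V" using sgraphD(2)[OF sg towardD(1)[OF u]] .
    from edge_parent[OF tr rV towardD(1)[OF u]] show ?thesis
    proof
      assume "v \<noteq> r \<and> u = p v"
      then have "?R i v" using us u i unfolding K_def by auto
      then show ?thesis by blast
    next
      assume "u \<noteq> r \<and> v = p u"
      then have "?R i u" using us u i uV unfolding K_def by auto
      then show ?thesis by blast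
    qed
  qed
  define g where "g i = (SOME c. ?R i c)" for i
  have g: "?R i (g i)" if "i \<in> ?I" for i
    unfolding g_def using someI_ex[OF ex[OF that]] .
  have "inj_on g ?I"
  proof (rule inj_onI)
    fix i j assume ij: "i \<in> ?I" "j \<in> ?I" "g i = g j"
    obtain x v y v' where iv: "i = (x, v)" "j = (y, v')" by (cases i; cases j)
    then have i: "i = (x, v)" "x \<in> S" "adj x v" and j: "j = (y, v')" "y \<in> S" "adj y v'"
      using ij by auto
    obtain u where u: "toward T v u x" "(v = g i \<and> u = p (g i)) \<or> (v = p (g i) \<and> u = g i)"
      using g[OF ij(1)] i(1) by auto
    obtain u' where u': "toward T v' u' y" "(v' = g i \<and> u' = p (g i)) \<or> (v' = p (g i) \<and> u' = g i)"
      using g[OF ij(2)] ij(3) j(1) by auto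
    have "(v = v' \<and> u = u') \<or> (v = u' \<and> u = v')" using u(2) u'(2) by blast
    then show "i = j"
    proof
      assume e: "v = v' \<and> u = u'"
      then have "x = y"
        using leaf_dirs_distinct[OF leaf_minimal, of x v u y] i j u u' S(1) by blast
      then show ?thesis using e i j by simp
    next
      assume "v = u' \<and> u = v'"
      then show ?thesis using used_antisym[OF i(2,3) u(1) j(2)] j(3) u'(1) by blast
    qed
  qed
  moreover have "g ` ?I \<subseteq> K" using g by blast
  moreover have "finite K" using finV unfolding K_def by simp
  ultimately have "card ?I \<le> card K" by (rule card_inj_on_le)
  moreover have "card ?I = (\<Sum>x\<in>S. deg V adj x)" using finS finV by (simp add: deg_def)
  ultimately show ?thesis by simp
qed

text \<open>Disjoint in \<open>V\<close> are \<open>K\<close>, one uncharged lower end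
  \<open>f w\<close> per branch vertex \<open>w\<close>, and the leaves outside \<open>S\<close>.
  For the topmost branch vertex \<open>f w\<close> may be \<open>r\<close>, which has no edge above
  it; \<open>r\<close> being in \<open>S\<close> keeps it out of the third set.\<close>

lemma degree_sum:
  "(\<Sum>x\<in>S. deg V adj x) + card (branches V T) + card (leaves V T - S) \<le> card V"
proof -
  have finV: "finite V" using sgraph_finite[OF sg] .
  define f where "f w = (SOME c. chain V T r w c \<and> c \<notin> K)" for w
  have f: "chain V T r w (f w)" "f w \<notin> K" if "w \<in> branches V T" for w
    using someI_ex[OF branch_unused_edge[OF that]] unfolding f_def by auto
  let ?B = "branches V T" and ?L = "leaves V T - S"
  have BV: "?B \<subseteq> V" unfolding branches_def by blast
  have "inj_on f ?B"
  proof (rule inj_onI)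
    fix w w' assume "w \<in> ?B" "w' \<in> ?B" "f w = f w'"
    then show "w = w'" using chain_inj[OF f(1)] f(1)[of w'] by metis
  qed
  then have cB: "card (f ` ?B) = card ?B" by (rule card_image)
  have fV: "f ` ?B \<subseteq> V" using chain_V[OF f(1)] BV by blast
  have fK: "f ` ?B \<inter> K = {}" using f(2) by blast
  have fL: "f ` ?B \<inter> ?L = {}"
  proof -
    have "f w \<notin> ?L" if w: "w \<in> ?B" for w
      using chain_deg[OF f(1)[OF w] w] S(2) leafD(2)[of "f w" V T] by fastforce
    then show ?thesis by blast
  qed
  have KL: "K \<inter> ?L = {}"
  proof -
    have "x \<notin> K" if x: "x \<in> leaves V T" "x \<notin> S" for x
    proof
      assume "x \<in> K"
      then consider "used x (p x)" | "used (p x) x" unfolding K_def by blast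
      then show False
      proof cases
        case 1
        then obtain y where "y \<in> S" "adj y x" unfolding used_def by blast
        then show False using leaves_nonadj[OF leaf_minimal _ x(1)] S(1) x(2) by blast
      next
        case 2
        then obtain y where "y \<in> S" "toward T (p x) x y" unfolding used_def by blast
        then show False using leaf_toward[OF tr _ leafD(1) x(1)] S(1) x(2) by blast
      qed
    qed
    then show ?thesis by blast
  qed
  have KV: "K \<subseteq> V" unfolding K_def by blast
  have LV: "?L \<subseteq> V" unfolding leaves_def by blast
  note fin = finite_subset[OF KV finV] finite_subset[OF LV finV] finite_subset[OF fV finV]
  have "card K + card (f ` ?B) + card ?L = card (K \<union> f ` ?B \<union> ?L)"
    using fin fK fL KL by (subst card_Un_disjoint; (subst card_Un_disjoint)?) auto
  also have "\<dots> \<le> card V" using KV LV fV finV by (intro card_mono) auto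
  finally show ?thesis using card_adjacencies cB by simp
qed

end

section \<open>The degree condition and the contradiction\<close>

lemma sigma_le:
  assumes "finite V" "indep V adj S" "card S = q"
  shows "sigma V adj q \<le> enat (\<Sum>v\<in>S. deg V adj v)"
proof -
  have fin: "finite {S. indep V adj S}"
    by (rule finite_subset[of _ "Pow V"]) (use assms(1) in \<open>auto simp: indep_def\<close>)
  \<comment> \<open>The set \<open>S\<close> itself excludes the infinite case of
    \<open>sigma\<close>.\<close>
  have "card S \<le> alpha V adj"
    unfolding alpha_def using fin assms(2) by (intro Max_ge) auto
  moreover have "{\<Sum>v\<in>S. deg V adj v | S. indep V adj S \<and> card S = q}
      = (\<lambda>S. \<Sum>v\<in>S. deg V adj v) ` {S. indep V adj S \<and> card S = q}" by blast
  then have "Min {\<Sum>v\<in>S. deg V adj v | S. indep V adj S \<and> card S = q} \<le> (\<Sum>v\<in>S. deg V adj v)"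
    using fin assms by (intro Min_le) auto
  ultimately show ?thesis using assms(3) unfolding sigma_def by auto
qed

theorem mainTheorem1:
  fixes V :: "'a set" and adj :: "'a \<Rightarrow> 'a \<Rightarrow> bool" and k m :: nat
  assumes "sgraph V adj" and "gconnected V adj" and "K14_free V adj"
    and "m \<le> k + 1"
    and "sigma V adj (m + 2) \<ge> enat (card V) - enat k"
  shows "\<exists>T. spanning_tree V adj T \<and> card (leaves V T) + card (branches V T) \<le> m + k + 2"
proof (rule ccontr)
  assume neg: "\<not> ?thesis"
  have finV: "finite V" using sgraph_finite[OF assms(1)] .
  have many: "m + k + 3 \<le> card (leaves V T) + card (branches V T)" if "tree V T" "T \<le> adj" for T
    using neg tree_spanning[OF that] by force
  have big: "card V \<ge> 2"
  proof -
    obtain T where T: "tree V T" "T \<le> adj" using tree_exists[OF assms(1,2)] by blast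
    have "leaves V T \<inter> branches V T = {}" "leaves V T \<union> branches V T \<subseteq> V"
      unfolding leaves_def branches_def by auto
    then have "card (leaves V T) + card (branches V T) \<le> card V"
      using card_Un_disjoint[of "leaves V T" "branches V T"] card_mono[OF finV]
      by (metis finV finite_Un finite_subset)
    then show ?thesis using many[OF T] by simp
  qed
  \<comment> \<open>The 2 from \<open>card_branches\<close> turns \<open>m + k + 3\<close> into
    \<open>m + k + 5\<close>. This is at least 5, giving three leaves, and at least
    \<open>2 * m + 4\<close> by \<open>m \<le> k + 1\<close>, giving \<open>m + 2\<close>
    leaves.\<close>
  have lv: "2 * card (leaves V T) \<ge> m + k + 5" if "tree V T" "T \<le> adj" for T
    using many[OF that] card_branches[OF that(1) big] by simp
  interpret three_leaf_host V adj
  proof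
    fix T assume "tree V T" "T \<le> adj"
    then show "3 \<le> card (leaves V T)" using lv by force
  qed (use assms in auto)
  obtain T0 where T0: "leaf_minimal V adj T0" using leaf_minimal_exists[OF assms(1,2)] by blast
  then have "leaves V T0 \<noteq> {}" using three_leaves[of T0] unfolding leaf_minimal_def by force
  then obtain T r where deep: "deepest V adj T r" using deepest_exists[OF T0] by blast
  then have T: "leaf_minimal V adj T" "r \<in> leaves V T" unfolding deepest_def by auto
  have tT: "tree V T" "T \<le> adj" using T(1) unfolding leaf_minimal_def by auto
  have finL: "finite (leaves V T)" using finite_leaves[OF leaf_minimalD(2)[OF T(1)]] .
  have "m + 1 \<le> card (leaves V T - {r})" using lv[OF tT] assms(4) T(2) finL by simp
  then obtain S0 where S0: "S0 \<subseteq> leaves V T - {r}" "card S0 = m + 1" "finite S0"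
    by (rule obtain_subset_with_card_n)
  let ?S = "insert r S0"
  have "r \<notin> S0" using S0(1) by blast
  then have S: "?S \<subseteq> leaves V T" "card ?S = m + 2" using S0 T(2) by auto
  interpret D: deep_tree V adj T r ?S
    by unfold_locales (fact deep, fact S(1), simp)
  have "indep V adj ?S"
    unfolding indep_def
  proof (intro conjI ballI)
    show "?S \<subseteq> V" using S(1) unfolding leaves_def by auto
    fix u v assume "u \<in> ?S" "v \<in> ?S"
    then have "u \<in> leaves V T" "v \<in> leaves V T" using S(1) by auto
    then show "\<not> adj u v"
      using leaves_nonadj[OF T(1), of u v] sgraphD(3)[OF assms(1), of u v] by (cases "u = v") auto
  qed
  from sigma_le[OF finV this S(2)]
  have "enat (card V) - enat k \<le> enat (\<Sum>x\<in>?S. deg V adj x)" using assms(5) by (rule order_trans[rotated])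
  then have "card V - k \<le> (\<Sum>x\<in>?S. deg V adj x)" by simp
  moreover have "card (leaves V T - ?S) = card (leaves V T) - (m + 2)"
    using S card_Diff_subset[of ?S "leaves V T"] S0(3) by simp
  moreover have "m + 2 \<le> card (leaves V T)" using card_mono[OF finL S(1)] S(2) by simp
  \<comment> \<open>Branch vertices and leaves outside \<open>?S\<close> number at least
    \<open>k + 1\<close>, so the degree sum is at most \<open>n - k - 1\<close>; in particular
    \<open>n > k\<close>, and the truncated difference \<open>card V - k\<close> is exact.\<close>
  ultimately show False using D.degree_sum many[OF tT] by linarith
qed

end
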